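(* Every Koras--Russell threefold is rational, i.e. birational to $\mathbb{P}^3_{\mathbb{C}}$.
   Context: A Koras--Russell threefold is a topologically contractible smooth affine threefold $X$ over $\mathbb{C}$ (i.e. $X(\mathbb{C})$ with the analytic topology is contractible) equipped with a hyperbolic algebraic action of $T=\mathbb{G}_m$ with a unique fixed point $o$, such that the affine quotient $X/\!/T=\operatorname{Spec}\mathcal{O}(X)^T$ is isomorphic to the affine quotient $T_oX/\!/T$ of the induced linear action on the tangent space $T_oX$. Hyperbolic means that all the weights of the $T$-representation $T_oX$ are nonzero and that both positive and negative weights occur. *)

theory Defs
  imports "HOL-Analysis.Analysis"
begin

section \<open>Spaces with complex-valued regular functions\<close>

text \<open>
  Varieties over the complex numbers are treated classically, as sets of closed points with the
  Zariski topology and, for every open set \<open>U\<close>, the functions that are regular on \<open>U\<close>.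
  Functions are total in HOL; only the values on \<open>U\<close> of an element of \<open>reg V U\<close> are relevant.
\<close>

record 'a space_with_functions =
  zar :: "'a topology"
  reg :: "'a set \<Rightarrow> ('a \<Rightarrow> complex) set"

definition morphism ::
  "'a space_with_functions \<Rightarrow> 'b space_with_functions \<Rightarrow> ('a \<Rightarrow> 'b) \<Rightarrow> bool" where
  "morphism V W \<phi> \<longleftrightarrow> continuous_map (zar V) (zar W) \<phi> \<and>
     (\<forall>U f. openin (zar W) U \<longrightarrow> f \<in> reg W U \<longrightarrow>
        f \<circ> \<phi> \<in> reg V {x \<in> topspace (zar V). \<phi> x \<in> U})"

definition isomorphic ::
  "'a space_with_functions \<Rightarrow> 'b space_with_functions \<Rightarrow> bool" where
  "isomorphic V W \<longleftrightarrow> (\<exists>\<phi> \<psi>. morphism V W \<phi> \<and> morphism W V \<psi> \<and>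
     (\<forall>x \<in> topspace (zar V). \<psi> (\<phi> x) = x) \<and> (\<forall>y \<in> topspace (zar W). \<phi> (\<psi> y) = y))"

definition open_subspace ::
  "'a space_with_functions \<Rightarrow> 'a set \<Rightarrow> 'a space_with_functions" where
  "open_subspace V U = \<lparr>zar = subtopology (zar V) U, reg = reg V\<rparr>"

text \<open>Meant for irreducible spaces, in which nonempty open subsets are dense.\<close>

definition birational ::
  "'a space_with_functions \<Rightarrow> 'b space_with_functions \<Rightarrow> bool" where
  "birational V W \<longleftrightarrow> (\<exists>A B. openin (zar V) A \<and> A \<noteq> {} \<and> openin (zar W) B \<and> B \<noteq> {} \<and>
     isomorphic (open_subspace V A) (open_subspace W B))"

text \<open>
  For an algebra \<open>R\<close> of functions on \<open>P\<close>, the non-vanishing loci of elements of \<open>R\<close> are closed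
  under finite intersections, hence a base of the generated topology.
\<close>

definition zariski_space ::
  "'a set \<Rightarrow> ('a \<Rightarrow> complex) set \<Rightarrow> 'a space_with_functions" where
  "zariski_space P R =
    (let T = topology_generated_by {{x \<in> P. f x \<noteq> 0} |f. f \<in> R}
     in \<lparr>zar = T,
         reg = (\<lambda>U. {f. \<forall>x \<in> U. \<exists>W g h. openin T W \<and> x \<in> W \<and> W \<subseteq> U \<and> g \<in> R \<and> h \<in> R \<and>
                          (\<forall>y \<in> W. h y \<noteq> 0 \<and> f y = g y / h y)})\<rparr>)"

definition irreducible_space :: "'a topology \<Rightarrow> bool" where
  "irreducible_space T \<longleftrightarrow> topspace T \<noteq> {} \<and>
     (\<forall>A B. closedin T A \<longrightarrow> closedin T B \<longrightarrow> A \<union> B = topspace T \<longrightarrow>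
        A = topspace T \<or> B = topspace T)"

definition krull_dim :: "'a topology \<Rightarrow> enat" where
  "krull_dim T = Sup {enat n |n. \<exists>Z.
     (\<forall>i \<le> n. closedin T (Z i) \<and> irreducible_space (subtopology T (Z i))) \<and>
     (\<forall>i < n. Z i \<subset> Z (Suc i))}"


section \<open>Affine varieties\<close>

inductive_set generated_algebra :: "('a \<Rightarrow> complex) set \<Rightarrow> ('a \<Rightarrow> complex) set"
  for G :: "('a \<Rightarrow> complex) set" where
  gen: "f \<in> G \<Longrightarrow> f \<in> generated_algebra G"
| const: "(\<lambda>_. c) \<in> generated_algebra G"
| add: "f \<in> generated_algebra G \<Longrightarrow> g \<in> generated_algebra G \<Longrightarrow>
    (\<lambda>x. f x + g x) \<in> generated_algebra G"
| mult: "f \<in> generated_algebra G \<Longrightarrow> g \<in> generated_algebra G \<Longrightarrow>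
    (\<lambda>x. f x * g x) \<in> generated_algebra G"

definition poly_functions :: "(complex ^ 'n \<Rightarrow> complex) set" where
  "poly_functions = generated_algebra (range (\<lambda>i x. x $ i))"

definition algebraic_set :: "(complex ^ 'n) set \<Rightarrow> bool" where
  "algebraic_set X \<longleftrightarrow> (\<exists>S \<subseteq> poly_functions. X = {x. \<forall>f \<in> S. f x = 0})"

definition coordinate_ring :: "(complex ^ 'n) set \<Rightarrow> (complex ^ 'n \<Rightarrow> complex) set" where
  "coordinate_ring X = (\<lambda>f. restrict f X) ` poly_functions"

definition affine_space_of :: "(complex ^ 'n) set \<Rightarrow> (complex ^ 'n) space_with_functions" where
  "affine_space_of X = zariski_space X (coordinate_ring X)"

definition affine_variety :: "(complex ^ 'n) set \<Rightarrow> bool" where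
  "affine_variety X \<longleftrightarrow> algebraic_set X \<and> irreducible_space (zar (affine_space_of X))"

definition variety_dim :: "(complex ^ 'n) set \<Rightarrow> enat" where
  "variety_dim X = krull_dim (zar (affine_space_of X))"

definition directional_deriv ::
  "(complex ^ 'n \<Rightarrow> complex) \<Rightarrow> complex ^ 'n \<Rightarrow> complex ^ 'n \<Rightarrow> complex" where
  "directional_deriv f x v = deriv (\<lambda>z. f (x + z *s v)) 0"

definition tangent_space :: "(complex ^ 'n) set \<Rightarrow> complex ^ 'n \<Rightarrow> (complex ^ 'n) set" where
  "tangent_space X x =
     {v. \<forall>f \<in> poly_functions. (\<forall>y \<in> X. f y = 0) \<longrightarrow> directional_deriv f x v = 0}"

definition smooth_variety :: "(complex ^ 'n) set \<Rightarrow> bool" where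
  "smooth_variety X \<longleftrightarrow> (\<forall>x \<in> X. enat (vec.dim (tangent_space X x)) = variety_dim X)"

text \<open>
  The differential at \<open>x \<in> X\<close> of a regular map \<open>F\<close> on \<open>X\<close>: each component of \<open>F\<close> is the restriction
  of some polynomial function, and for \<open>v \<in> tangent_space X x\<close> the result does not depend on which
  one is chosen.
\<close>

definition differential ::
  "(complex ^ 'n) set \<Rightarrow> (complex ^ 'n \<Rightarrow> complex ^ 'm) \<Rightarrow> complex ^ 'n \<Rightarrow>
    complex ^ 'n \<Rightarrow> complex ^ 'm" where
  "differential X F x v =
     (\<chi> i. directional_deriv (SOME f. f \<in> poly_functions \<and> (\<forall>y \<in> X. f y = F y $ i)) x v)"

text \<open>
  The affine variety whose ring of regular functions is \<open>A\<close>, a finitely generated algebra of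
  functions on \<open>X\<close>. Its points (the maximal ideals of \<open>A\<close>) are given as the algebra homomorphisms
  from \<open>A\<close> to the complex numbers.
\<close>

definition algebra_characters ::
  "'a set \<Rightarrow> ('a \<Rightarrow> complex) set \<Rightarrow> (('a \<Rightarrow> complex) \<Rightarrow> complex) set" where
  "algebra_characters X A = {\<xi> \<in> extensional A.
     (\<forall>c. \<xi> (\<lambda>x\<in>X. c) = c) \<and>
     (\<forall>f \<in> A. \<forall>g \<in> A. \<xi> (\<lambda>x\<in>X. f x + g x) = \<xi> f + \<xi> g \<and> \<xi> (\<lambda>x\<in>X. f x * g x) = \<xi> f * \<xi> g)}"

definition spectrum ::
  "'a set \<Rightarrow> ('a \<Rightarrow> complex) set \<Rightarrow> (('a \<Rightarrow> complex) \<Rightarrow> complex) space_with_functions" where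
  "spectrum X A = zariski_space (algebra_characters X A) ((\<lambda>f \<xi>. \<xi> f) ` A)"


section \<open>Actions of the multiplicative group\<close>

text \<open>
  An action is a map \<open>\<sigma> :: complex \<Rightarrow> complex ^ 'n \<Rightarrow> complex ^ 'n\<close>, of which only the values at
  nonzero scalars and at points of \<open>X\<close> matter. It is algebraic if it is a morphism on the product of
  the multiplicative group and \<open>X\<close>, whose ring of regular functions is generated by \<open>t\<close>, its inverse
  and the coordinates of \<open>x\<close>.
\<close>

definition laurent_poly_functions :: "(complex \<times> (complex ^ 'n) \<Rightarrow> complex) set" where
  "laurent_poly_functions = generated_algebra
     ({\<lambda>(t, x). t, \<lambda>(t, x). inverse t} \<union> range (\<lambda>i (t, x). x $ i))"

definition algebraic_Gm_action ::
  "(complex ^ 'n) set \<Rightarrow> (complex \<Rightarrow> complex ^ 'n \<Rightarrow> complex ^ 'n) \<Rightarrow> bool" where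
  "algebraic_Gm_action X \<sigma> \<longleftrightarrow>
     (\<forall>t. t \<noteq> 0 \<longrightarrow> (\<forall>x \<in> X. \<sigma> t x \<in> X)) \<and>
     (\<forall>x \<in> X. \<sigma> 1 x = x) \<and>
     (\<forall>s t. s \<noteq> 0 \<longrightarrow> t \<noteq> 0 \<longrightarrow> (\<forall>x \<in> X. \<sigma> (s * t) x = \<sigma> s (\<sigma> t x))) \<and>
     (\<forall>i. \<exists>f \<in> laurent_poly_functions. \<forall>t. t \<noteq> 0 \<longrightarrow> (\<forall>x \<in> X. \<sigma> t x $ i = f (t, x)))"

definition fixed_points ::
  "(complex ^ 'n) set \<Rightarrow> (complex \<Rightarrow> complex ^ 'n \<Rightarrow> complex ^ 'n) \<Rightarrow> (complex ^ 'n) set" where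
  "fixed_points X \<sigma> = {x \<in> X. \<forall>t. t \<noteq> 0 \<longrightarrow> \<sigma> t x = x}"

definition invariant_ring ::
  "(complex ^ 'n) set \<Rightarrow> (complex \<Rightarrow> complex ^ 'n \<Rightarrow> complex ^ 'n) \<Rightarrow>
    (complex ^ 'n \<Rightarrow> complex) set" where
  "invariant_ring X \<sigma> = {f \<in> coordinate_ring X. \<forall>t. t \<noteq> 0 \<longrightarrow> (\<forall>x \<in> X. f (\<sigma> t x) = f x)}"

definition affine_quotient ::
  "(complex ^ 'n) set \<Rightarrow> (complex \<Rightarrow> complex ^ 'n \<Rightarrow> complex ^ 'n) \<Rightarrow>
    ((complex ^ 'n \<Rightarrow> complex) \<Rightarrow> complex) space_with_functions" where
  "affine_quotient X \<sigma> = spectrum X (invariant_ring X \<sigma>)"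

definition tangent_action ::
  "(complex ^ 'n) set \<Rightarrow> (complex \<Rightarrow> complex ^ 'n \<Rightarrow> complex ^ 'n) \<Rightarrow> complex ^ 'n \<Rightarrow>
    complex \<Rightarrow> complex ^ 'n \<Rightarrow> complex ^ 'n" where
  "tangent_action X \<sigma> p t = differential X (\<sigma> t) p"

definition weights ::
  "(complex ^ 'n) set \<Rightarrow> (complex \<Rightarrow> complex ^ 'n \<Rightarrow> complex ^ 'n) \<Rightarrow> int set" where
  "weights V \<rho> = {k. \<exists>v \<in> V. v \<noteq> 0 \<and> (\<forall>t. t \<noteq> 0 \<longrightarrow> \<rho> t v = (t powi k) *s v)}"

definition hyperbolic_at ::
  "(complex ^ 'n) set \<Rightarrow> (complex \<Rightarrow> complex ^ 'n \<Rightarrow> complex ^ 'n) \<Rightarrow> complex ^ 'n \<Rightarrow> bool" where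
  "hyperbolic_at X \<sigma> p \<longleftrightarrow>
     (let K = weights (tangent_space X p) (tangent_action X \<sigma> p)
      in 0 \<notin> K \<and> (\<exists>k \<in> K. k > 0) \<and> (\<exists>k \<in> K. k < 0))"

text \<open>
  Contractibility refers to the Euclidean topology of the ambient space, which induces the analytic
  topology on \<open>X\<close>.
\<close>

definition Koras_Russell_threefold ::
  "(complex ^ 'n) set \<Rightarrow> (complex \<Rightarrow> complex ^ 'n \<Rightarrow> complex ^ 'n) \<Rightarrow> bool" where
  "Koras_Russell_threefold X \<sigma> \<longleftrightarrow>
     affine_variety X \<and> variety_dim X = 3 \<and> smooth_variety X \<and> contractible X \<and>
     algebraic_Gm_action X \<sigma> \<and>
     (\<exists>p. fixed_points X \<sigma> = {p} \<and> hyperbolic_at X \<sigma> p \<and>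
        isomorphic (affine_quotient X \<sigma>)
          (affine_quotient (tangent_space X p) (tangent_action X \<sigma> p)))"


section \<open>Projective space\<close>

definition homogeneous :: "nat \<Rightarrow> (complex ^ 'n \<Rightarrow> complex) \<Rightarrow> bool" where
  "homogeneous d F \<longleftrightarrow> F \<in> poly_functions \<and> (\<forall>c v. F (c *s v) = c ^ d * F v)"

text \<open>
  The points are the lines through the origin in \<open>complex ^ 'n\<close>, so the dimension is one less than
  the number of homogeneous coordinates.
\<close>

definition projective_points :: "(complex ^ 'n) set set" where
  "projective_points = {vec.span {v} |v. v \<noteq> 0}"

definition projective_space :: "(complex ^ 'n) set space_with_functions" where
  "projective_space =
    (let T = topology_generated_by
               {{L \<in> projective_points. \<exists>v \<in> L. F v \<noteq> 0} |F. \<exists>d. homogeneous d F}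
     in \<lparr>zar = T,
         reg = (\<lambda>U. {f. \<forall>L \<in> U. \<exists>W d G H. openin T W \<and> L \<in> W \<and> W \<subseteq> U \<and>
                          homogeneous d G \<and> homogeneous d H \<and>
                          (\<forall>M \<in> W. \<forall>v \<in> M - {0}. H v \<noteq> 0 \<and> f M = G v / H v)})\<rparr>)"

abbreviation projective_3_space :: "(complex ^ 4) set space_with_functions" where
  "projective_3_space \<equiv> projective_space"

end

theory Submission
  imports Defs
begin

text \<open>
  Let \<open>B\<close> be the ring of invariants of the action of \<open>T\<close> on \<open>X\<close>. The coordinate ring of \<open>X\<close> is
  graded by the weights of \<open>T\<close>, and it is an integral domain. A tangent vector at the fixed point
  that has weight \<open>k\<close> and a nonzero \<open>i\<close>-th coordinate is not killed by the differential of the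
  weight-\<open>k\<close> part of the \<open>i\<close>-th coordinate function; as the action is hyperbolic, there are
  therefore nonzero homogeneous functions of positive and of negative weight
  (\<open>semi_invariant_of_tangent_weight\<close>). Products of nonzero functions being nonzero, the weights that
  occur are closed under addition, and having both signs they form a group \<open>d\<int>\<close>. Choose \<open>u \<noteq> 0\<close>
  of weight \<open>d\<close> and \<open>w \<noteq> 0\<close> of weight \<open>- d\<close>, and put \<open>g = u w \<in> B\<close>. Once \<open>g\<close> is inverted, a function
  of weight \<open>k d\<close> is the product of \<open>u\<^sup>k\<close> with a fraction of invariants, so that the localised
  coordinate ring is \<open>B\<^sub>g[u, u\<^sup>-\<^sup>1]\<close>: the open set \<open>g \<noteq> 0\<close> of \<open>X\<close> is the product of the open set
  \<open>g \<noteq> 0\<close> of the quotient and the multiplicative group (\<open>quotient_splitting_exists\<close>).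

  The tangent space \<open>V\<close> at the fixed point, with its linear action, is an integral affine variety on
  which weights of both signs occur, so the same applies to it. An isomorphism of the two quotients,
  multiplied by the identity of the multiplicative group, is then a birational map from \<open>X\<close> to \<open>V\<close>
  (\<open>birational_if_quotients_isomorphic\<close>). Finally \<open>V\<close> is a vector space whose dimension is that
  of \<open>X\<close>, hence isomorphic to a standard affine chart of projective 3-space
  (\<open>subspace_isomorphic_projective_chart\<close>).
\<close>

section \<open>Spaces of locally defined fractions\<close>

lemma morphism_comp:
  assumes "morphism V W f" "morphism W Z g"
  shows "morphism V Z (g \<circ> f)"
  unfolding morphism_def
proof (intro conjI allI impI)
  show "continuous_map (zar V) (zar Z) (g \<circ> f)"
    using assms continuous_map_compose by (auto simp: morphism_def)
next
  fix U h assume U: "openin (zar Z) U" and h: "h \<in> reg Z U"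
  let ?W = "{y \<in> topspace (zar W). g y \<in> U}"
  have "h \<circ> g \<in> reg W ?W" and "openin (zar W) ?W"
    using assms(2) U h openin_continuous_map_preimage by (auto simp: morphism_def)
  then have "(h \<circ> g) \<circ> f \<in> reg V {x \<in> topspace (zar V). f x \<in> ?W}"
    using assms(1) unfolding morphism_def by blast
  moreover have "{x \<in> topspace (zar V). f x \<in> ?W} = {x \<in> topspace (zar V). (g \<circ> f) x \<in> U}"
    using assms(1) by (auto simp: morphism_def continuous_map_def)
  ultimately show "h \<circ> (g \<circ> f) \<in> reg V {x \<in> topspace (zar V). (g \<circ> f) x \<in> U}"
    by (simp add: comp_assoc)
qed

lemma zar_open_subspace [simp]: "zar (open_subspace V A) = subtopology (zar V) A"
  and reg_open_subspace [simp]: "reg (open_subspace V A) = reg V"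
  by (simp_all add: open_subspace_def)

lemma morphism_into_open_subspace:
  assumes "morphism V W f" "openin (zar W) B" "\<And>x. x \<in> topspace (zar V) \<Longrightarrow> f x \<in> B"
  shows "morphism V (open_subspace W B) f"
  using assms
  by (auto simp: morphism_def continuous_map_in_subtopology openin_open_subtopology)

text \<open>
  The properties of a structure sheaf on which the argument rests. Affine varieties, quotients and
  projective space all have them, so that the regularity of a map can be checked in each case by
  calculating with coordinates, without returning to the fractions that define regularity.
\<close>

locale function_space =
  fixes S :: "'a space_with_functions"
  assumes reg_cong: "\<lbrakk>openin (zar S) U; f \<in> reg S U; \<And>x. x \<in> U \<Longrightarrow> f' x = f x\<rbrakk> \<Longrightarrow> f' \<in> reg S U"
    and reg_subset: "\<lbrakk>openin (zar S) U; openin (zar S) U'; U' \<subseteq> U; f \<in> reg S U\<rbrakk> \<Longrightarrow> f \<in> reg S U'"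
    and reg_local: "\<lbrakk>openin (zar S) U;
          \<And>x. x \<in> U \<Longrightarrow> \<exists>W. openin (zar S) W \<and> x \<in> W \<and> W \<subseteq> U \<and> f \<in> reg S W\<rbrakk> \<Longrightarrow> f \<in> reg S U"
    and reg_const: "openin (zar S) U \<Longrightarrow> (\<lambda>_. c) \<in> reg S U"
    and reg_add: "\<lbrakk>openin (zar S) U; f \<in> reg S U; f' \<in> reg S U\<rbrakk> \<Longrightarrow> (\<lambda>x. f x + f' x) \<in> reg S U"
    and reg_mult: "\<lbrakk>openin (zar S) U; f \<in> reg S U; f' \<in> reg S U\<rbrakk> \<Longrightarrow> (\<lambda>x. f x * f' x) \<in> reg S U"
    and reg_inverse: "\<lbrakk>openin (zar S) U; f \<in> reg S U; \<And>x. x \<in> U \<Longrightarrow> f x \<noteq> 0\<rbrakk>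
          \<Longrightarrow> (\<lambda>x. inverse (f x)) \<in> reg S U"
    and openin_nonzero: "\<lbrakk>openin (zar S) U; f \<in> reg S U\<rbrakk> \<Longrightarrow> openin (zar S) {x \<in> U. f x \<noteq> 0}"
begin

lemma reg_divide:
  "\<lbrakk>openin (zar S) U; f \<in> reg S U; f' \<in> reg S U; \<And>x. x \<in> U \<Longrightarrow> f' x \<noteq> 0\<rbrakk>
    \<Longrightarrow> (\<lambda>x. f x / f' x) \<in> reg S U"
  unfolding divide_inverse by (intro reg_mult reg_inverse)

lemma reg_sum:
  assumes "openin (zar S) U" "\<And>i. i \<in> I \<Longrightarrow> f i \<in> reg S U"
  shows "(\<lambda>x. \<Sum>i\<in>I. f i x) \<in> reg S U"
  using assms(2) by (induction I rule: infinite_finite_induct) (auto intro: reg_const reg_add assms(1))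

lemma reg_power:
  "\<lbrakk>openin (zar S) U; f \<in> reg S U\<rbrakk> \<Longrightarrow> (\<lambda>x. f x ^ n) \<in> reg S U"
  by (induction n) (auto intro: reg_const reg_mult)

lemma reg_powi:
  "\<lbrakk>openin (zar S) U; f \<in> reg S U; \<And>x. x \<in> U \<Longrightarrow> f x \<noteq> 0\<rbrakk> \<Longrightarrow> (\<lambda>x. f x powi k) \<in> reg S U"
  by (cases "k \<ge> 0") (auto simp: power_int_def intro!: reg_power reg_inverse)

lemma function_space_open_subspace:
  assumes "openin (zar S) A"
  shows "function_space (open_subspace S A)"
proof -
  have [simp]: "openin (subtopology (zar S) A) U \<longleftrightarrow> openin (zar S) U \<and> U \<subseteq> A" for U
    using assms by (rule openin_open_subtopology)
  show ?thesis
  proof (unfold_locales, goal_cases)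
    case (3 U f)
    then have "\<exists>W. openin (zar S) W \<and> x \<in> W \<and> W \<subseteq> U \<and> f \<in> reg S W" if "x \<in> U" for x
      using that by fastforce
    with 3(1) show ?case
      using reg_local[of U f] by simp
  qed (simp_all add: reg_const reg_add reg_mult reg_inverse openin_nonzero subset_iff,
       auto intro: reg_cong reg_subset)
qed

lemma morphism_open_subspace:
  assumes "openin (zar S) A" "morphism S W f"
  shows "morphism (open_subspace S A) W f"
  unfolding morphism_def
proof (intro conjI allI impI)
  show "continuous_map (zar (open_subspace S A)) (zar W) f"
    using assms by (simp add: morphism_def continuous_map_from_subtopology)
next
  fix U h assume U: "openin (zar W) U" and h: "h \<in> reg W U"
  let ?P = "{x \<in> topspace (zar S). f x \<in> U}"
  have P: "h \<circ> f \<in> reg S ?P" "openin (zar S) ?P"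
    using assms U h openin_continuous_map_preimage by (auto simp: morphism_def)
  have "{x \<in> topspace (zar (open_subspace S A)). f x \<in> U} = ?P \<inter> A"
    by auto
  then show "h \<circ> f \<in> reg (open_subspace S A) {x \<in> topspace (zar (open_subspace S A)). f x \<in> U}"
    using reg_subset[OF P(2) _ _ P(1), of "?P \<inter> A"] P(2) assms(1) by auto
qed

end

text \<open>
  Here \<open>fr W\<close> stands for the functions given by a single fraction on all of \<open>W\<close>. Finitely many
  such presentations near a point hold on a common neighbourhood, so closure properties pass from
  \<open>fr\<close> to the regular functions.
\<close>

lemma function_space_if_locally:
  fixes S :: "'a space_with_functions" and fr :: "'a set \<Rightarrow> ('a \<Rightarrow> complex) set"
  assumes reg: "\<And>U f. f \<in> reg S U \<longleftrightarrow>
      (\<forall>x\<in>U. \<exists>W. openin (zar S) W \<and> x \<in> W \<and> W \<subseteq> U \<and> f \<in> fr W)"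
    and mono: "\<And>W W' f. \<lbrakk>f \<in> fr W; W' \<subseteq> W\<rbrakk> \<Longrightarrow> f \<in> fr W'"
    and cong: "\<And>W f f'. \<lbrakk>f \<in> fr W; \<And>x. x \<in> W \<Longrightarrow> f' x = f x\<rbrakk> \<Longrightarrow> f' \<in> fr W"
    and const: "\<And>W c. openin (zar S) W \<Longrightarrow> (\<lambda>_. c) \<in> fr W"
    and add: "\<And>W f f'. \<lbrakk>openin (zar S) W; f \<in> fr W; f' \<in> fr W\<rbrakk> \<Longrightarrow> (\<lambda>x. f x + f' x) \<in> fr W"
    and mult: "\<And>W f f'. \<lbrakk>openin (zar S) W; f \<in> fr W; f' \<in> fr W\<rbrakk> \<Longrightarrow> (\<lambda>x. f x * f' x) \<in> fr W"
    and inverse: "\<And>W f. \<lbrakk>openin (zar S) W; f \<in> fr W; \<And>x. x \<in> W \<Longrightarrow> f x \<noteq> 0\<rbrakk>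
      \<Longrightarrow> (\<lambda>x. inverse (f x)) \<in> fr W"
    and nonzero: "\<And>W f. \<lbrakk>openin (zar S) W; f \<in> fr W\<rbrakk> \<Longrightarrow> openin (zar S) {x \<in> W. f x \<noteq> 0}"
  shows "function_space S"
proof -
  have nbhd: "\<exists>W. openin (zar S) W \<and> x \<in> W \<and> W \<subseteq> U \<and> f \<in> fr W \<and> f' \<in> fr W"
    if ff: "f \<in> reg S U" "f' \<in> reg S U" and x: "x \<in> U" for U f f' x
  proof -
    obtain W where "openin (zar S) W" "x \<in> W" "W \<subseteq> U" "f \<in> fr W"
      using ff(1) x unfolding reg by blast
    moreover obtain W' where "openin (zar S) W'" "x \<in> W'" "W' \<subseteq> U" "f' \<in> fr W'"
      using ff(2) x unfolding reg by blast
    ultimately show ?thesis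
      by (intro exI[of _ "W \<inter> W'"]) (auto intro: mono)
  qed
  show ?thesis
  proof
    fix U f f' assume "openin (zar S) U" "f \<in> reg S U" "\<And>x. x \<in> U \<Longrightarrow> f' x = f x"
    then show "f' \<in> reg S U"
      unfolding reg using cong by (meson subset_iff)
  next
    fix U U' f assume *: "openin (zar S) U'" "U' \<subseteq> U" "f \<in> reg S U"
    show "f \<in> reg S U'"
      unfolding reg
    proof
      fix x assume "x \<in> U'"
      then have "x \<in> U" using *(2) by blast
      then obtain W where "openin (zar S) W" "x \<in> W" "f \<in> fr W"
        using *(3) unfolding reg by blast
      then show "\<exists>W. openin (zar S) W \<and> x \<in> W \<and> W \<subseteq> U' \<and> f \<in> fr W"
        using * \<open>x \<in> U'\<close> by (intro exI[of _ "W \<inter> U'"]) (auto intro: mono)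
    qed
  next
    fix U f assume "\<And>x. x \<in> U \<Longrightarrow> \<exists>W. openin (zar S) W \<and> x \<in> W \<and> W \<subseteq> U \<and> f \<in> reg S W"
    then show "f \<in> reg S U"
      unfolding reg by (meson order_trans)
  next
    fix U c assume "openin (zar S) U"
    then show "(\<lambda>_. c) \<in> reg S U"
      unfolding reg using const by blast
  next
    fix U f f' assume "f \<in> reg S U" "f' \<in> reg S U"
    note * = nbhd[OF this]
    show "(\<lambda>x. f x + f' x) \<in> reg S U"
      unfolding reg
    proof
      fix x assume "x \<in> U"
      then obtain W where W: "openin (zar S) W" "x \<in> W" "W \<subseteq> U" "f \<in> fr W" "f' \<in> fr W"
        using * by meson
      then show "\<exists>W. openin (zar S) W \<and> x \<in> W \<and> W \<subseteq> U \<and> (\<lambda>x. f x + f' x) \<in> fr W"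
        using add[OF W(1,4,5)] by (intro exI[of _ W]) simp
    qed
    show "(\<lambda>x. f x * f' x) \<in> reg S U"
      unfolding reg
    proof
      fix x assume "x \<in> U"
      then obtain W where W: "openin (zar S) W" "x \<in> W" "W \<subseteq> U" "f \<in> fr W" "f' \<in> fr W"
        using * by meson
      then show "\<exists>W. openin (zar S) W \<and> x \<in> W \<and> W \<subseteq> U \<and> (\<lambda>x. f x * f' x) \<in> fr W"
        using mult[OF W(1,4,5)] by (intro exI[of _ W]) simp
    qed
  next
    fix U f assume f: "f \<in> reg S U" and nz: "\<And>x. x \<in> U \<Longrightarrow> f x \<noteq> 0"
    show "(\<lambda>x. inverse (f x)) \<in> reg S U"
      unfolding reg
    proof
      fix x assume "x \<in> U"
      then obtain W where W: "openin (zar S) W" "x \<in> W" "W \<subseteq> U" "f \<in> fr W"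
        using f unfolding reg by meson
      then show "\<exists>W. openin (zar S) W \<and> x \<in> W \<and> W \<subseteq> U \<and> (\<lambda>x. inverse (f x)) \<in> fr W"
        using inverse[OF W(1,4)] nz by (intro exI[of _ W]) blast
    qed
  next
    fix U f assume f: "f \<in> reg S U"
    show "openin (zar S) {x \<in> U. f x \<noteq> 0}"
    proof (subst openin_subopen, safe)
      fix x assume "x \<in> U" "f x \<noteq> 0"
      then obtain W where "openin (zar S) W" "x \<in> W" "W \<subseteq> U" "f \<in> fr W"
        using f unfolding reg by blast
      then show "\<exists>T. openin (zar S) T \<and> x \<in> T \<and> T \<subseteq> {x \<in> U. f x \<noteq> 0}"
        using nonzero \<open>f x \<noteq> 0\<close> by (intro exI[of _ "{x \<in> W. f x \<noteq> 0}"]) auto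
    qed
  qed
qed

text \<open>
  The operations are required up to equality on \<open>P\<close> only: the elements of a coordinate ring are
  \<open>undefined\<close> outside the variety, and the pointwise sum of two of them is not.
\<close>

definition function_algebra :: "'a set \<Rightarrow> ('a \<Rightarrow> complex) set \<Rightarrow> bool" where
  "function_algebra P R \<longleftrightarrow>
     (\<forall>c. \<exists>k\<in>R. \<forall>x\<in>P. k x = c) \<and>
     (\<forall>f\<in>R. \<forall>g\<in>R. (\<exists>k\<in>R. \<forall>x\<in>P. k x = f x + g x) \<and> (\<exists>k\<in>R. \<forall>x\<in>P. k x = f x * g x))"

lemma function_algebra_const:
  assumes "function_algebra P R"
  obtains k where "k \<in> R" "\<And>x. x \<in> P \<Longrightarrow> k x = c"
proof -
  have "\<exists>k\<in>R. \<forall>x\<in>P. k x = c"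
    using assms by (simp add: function_algebra_def)
  then show thesis
    by (elim bexE) (rule that, assumption, drule (1) bspec)
qed

lemma function_algebra_add:
  assumes "function_algebra P R" "f \<in> R" "g \<in> R"
  obtains k where "k \<in> R" "\<And>x. x \<in> P \<Longrightarrow> k x = f x + g x"
proof -
  have "\<exists>k\<in>R. \<forall>x\<in>P. k x = f x + g x"
    using assms by (simp add: function_algebra_def)
  then show thesis
    by (elim bexE) (rule that, assumption, drule (1) bspec)
qed

lemma function_algebra_mult:
  assumes "function_algebra P R" "f \<in> R" "g \<in> R"
  obtains k where "k \<in> R" "\<And>x. x \<in> P \<Longrightarrow> k x = f x * g x"
proof -
  have "\<exists>k\<in>R. \<forall>x\<in>P. k x = f x * g x"
    using assms by (simp add: function_algebra_def)
  then show thesis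
    by (elim bexE) (rule that, assumption, drule (1) bspec)
qed

lemma zar_zariski_space:
  "zar (zariski_space P R) = topology_generated_by {{x \<in> P. f x \<noteq> 0} |f. f \<in> R}"
  by (simp add: zariski_space_def Let_def)

lemma reg_zariski_space:
  "f \<in> reg (zariski_space P R) U \<longleftrightarrow>
    (\<forall>x\<in>U. \<exists>W g h. openin (zar (zariski_space P R)) W \<and> x \<in> W \<and> W \<subseteq> U \<and> g \<in> R \<and> h \<in> R \<and>
        (\<forall>y\<in>W. h y \<noteq> 0 \<and> f y = g y / h y))"
  by (simp add: zariski_space_def Let_def)

lemma topspace_zariski_space:
  assumes "function_algebra P R"
  shows "topspace (zar (zariski_space P R)) = P"
proof -
  obtain k where "k \<in> R" "\<And>x. x \<in> P \<Longrightarrow> k x = 1"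
    by (rule function_algebra_const[OF assms, of 1]) blast
  then have "P \<in> {{x \<in> P. f x \<noteq> 0} |f. f \<in> R}"
    by (intro CollectI exI[of _ k]) auto
  then have "\<Union>{{x \<in> P. f x \<noteq> 0} |f. f \<in> R} = P"
    by (intro equalityI Union_upper) auto
  then show ?thesis
    by (simp only: zar_zariski_space topology_generated_by_topspace)
qed

lemma openin_zariski_space:
  assumes "f \<in> R"
  shows "openin (zar (zariski_space P R)) {x \<in> P. f x \<noteq> 0}"
  unfolding zar_zariski_space
  by (rule topology_generated_by_Basis, intro CollectI exI[of _ f]) (simp add: assms)

lemma function_space_zariski_space:
  assumes R: "function_algebra P R"
  shows "function_space (zariski_space P R)"
proof (rule function_space_if_locally)
  let ?S = "zariski_space P R"
  define fr where "fr = (\<lambda>W. {f. \<exists>g h. g \<in> R \<and> h \<in> R \<and> (\<forall>y\<in>W. h y \<noteq> 0 \<and> f y = g y / h y)})"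
  have fr_iff: "f \<in> fr W \<longleftrightarrow> (\<exists>g h. g \<in> R \<and> h \<in> R \<and> (\<forall>y\<in>W. h y \<noteq> 0 \<and> f y = g y / h y))" for f W
    by (simp add: fr_def)
  have sub: "W \<subseteq> P" if "openin (zar ?S) W" for W
    using openin_subset[OF that] topspace_zariski_space[OF R] by simp
  show "f \<in> reg ?S U \<longleftrightarrow> (\<forall>x\<in>U. \<exists>W. openin (zar ?S) W \<and> x \<in> W \<and> W \<subseteq> U \<and> f \<in> fr W)" for U f
    by (simp add: reg_zariski_space fr_iff)
  show "f \<in> fr W'" if "f \<in> fr W" "W' \<subseteq> W" for W W' f
    using that unfolding fr_iff by (meson subsetD)
  show "f' \<in> fr W" if "f \<in> fr W" "\<And>x. x \<in> W \<Longrightarrow> f' x = f x" for W f f'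
    using that unfolding fr_iff by metis
  show "(\<lambda>_. c) \<in> fr W" if "openin (zar ?S) W" for W c
  proof -
    obtain g where g: "g \<in> R" "\<And>x. x \<in> P \<Longrightarrow> g x = c"
      by (rule function_algebra_const[OF R, of c]) blast
    obtain h where h: "h \<in> R" "\<And>x. x \<in> P \<Longrightarrow> h x = 1"
      by (rule function_algebra_const[OF R, of 1]) blast
    have "\<forall>y\<in>W. h y \<noteq> 0 \<and> c = g y / h y"
      using sub[OF that] g(2) h(2) by auto
    then show ?thesis
      unfolding fr_iff using g(1) h(1) by meson
  qed
  fix W assume "openin (zar ?S) W"
  note W = sub[OF this] and opW = this
  show "(\<lambda>x. f x + f' x) \<in> fr W" "(\<lambda>x. f x * f' x) \<in> fr W" if ff: "f \<in> fr W" "f' \<in> fr W" for f f'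
  proof -
    obtain g h where gh: "g \<in> R" "h \<in> R" "\<forall>y\<in>W. h y \<noteq> 0 \<and> f y = g y / h y"
      using ff(1) unfolding fr_iff by meson
    obtain g' h' where gh': "g' \<in> R" "h' \<in> R" "\<forall>y\<in>W. h' y \<noteq> 0 \<and> f' y = g' y / h' y"
      using ff(2) unfolding fr_iff by meson
    obtain k where k: "k \<in> R" "\<And>x. x \<in> P \<Longrightarrow> k x = h x * h' x"
      by (rule function_algebra_mult[OF R gh(2) gh'(2)]) blast
    obtain l where l: "l \<in> R" "\<And>x. x \<in> P \<Longrightarrow> l x = g x * g' x"
      by (rule function_algebra_mult[OF R gh(1) gh'(1)]) blast
    obtain m where m: "m \<in> R" "\<And>x. x \<in> P \<Longrightarrow> m x = g x * h' x"
      by (rule function_algebra_mult[OF R gh(1) gh'(2)]) blast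
    obtain m' where m': "m' \<in> R" "\<And>x. x \<in> P \<Longrightarrow> m' x = g' x * h x"
      by (rule function_algebra_mult[OF R gh'(1) gh(2)]) blast
    obtain n where n: "n \<in> R" "\<And>x. x \<in> P \<Longrightarrow> n x = m x + m' x"
      by (rule function_algebra_add[OF R m(1) m'(1)]) blast
    have "\<forall>y\<in>W. k y \<noteq> 0 \<and> f y * f' y = l y / k y"
      using k l gh gh' W by auto
    then show "(\<lambda>x. f x * f' x) \<in> fr W"
      unfolding fr_iff using k(1) l(1) by meson
    have "\<forall>y\<in>W. k y \<noteq> 0 \<and> f y + f' y = n y / k y"
      using k m m' n gh gh' W by (auto simp: field_simps)
    then show "(\<lambda>x. f x + f' x) \<in> fr W"
      unfolding fr_iff using k(1) n(1) by meson
  qed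
  show "(\<lambda>x. inverse (f x)) \<in> fr W" if ff: "f \<in> fr W" "\<And>x. x \<in> W \<Longrightarrow> f x \<noteq> 0" for f
  proof -
    obtain g h where "g \<in> R" "h \<in> R" "\<forall>y\<in>W. h y \<noteq> 0 \<and> f y = g y / h y"
      using ff(1) unfolding fr_iff by meson
    then show ?thesis
      unfolding fr_iff using ff(2) by (intro exI[of _ h] exI[of _ g]) auto
  qed
  show "openin (zar ?S) {x \<in> W. f x \<noteq> 0}" if f: "f \<in> fr W" for f
  proof -
    obtain g h where gh: "g \<in> R" "h \<in> R" "\<forall>y\<in>W. h y \<noteq> 0 \<and> f y = g y / h y"
      using f unfolding fr_iff by meson
    have "{x \<in> W. f x \<noteq> 0} = W \<inter> {x \<in> P. g x \<noteq> 0}"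
      using W gh(3) by auto
    then show ?thesis
      using opW openin_zariski_space[OF gh(1)] by auto
  qed
qed

lemma algebra_reg_zariski_space:
  assumes R: "function_algebra P R" and "f \<in> R" "openin (zar (zariski_space P R)) U"
  shows "f \<in> reg (zariski_space P R) U"
proof -
  obtain k where "k \<in> R" "\<And>x. x \<in> P \<Longrightarrow> k x = 1"
    by (rule function_algebra_const[OF R, of 1]) blast
  moreover have "U \<subseteq> P"
    using openin_subset[OF assms(3)] topspace_zariski_space[OF R] by simp
  ultimately show ?thesis
    unfolding reg_zariski_space using assms(2,3)
    by (intro ballI exI[of _ U] exI[of _ f] exI[of _ k]) auto
qed

text \<open>
  A fraction of elements of \<open>R\<close> pulls back to a quotient of regular functions, which settles both
  continuity and the regularity of the pullback.
\<close>

lemma (in function_space) morphism_into_zariski_space: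
  assumes R: "function_algebra P R"
    and into: "\<And>x. x \<in> topspace (zar S) \<Longrightarrow> \<phi> x \<in> P"
    and pull: "\<And>f. f \<in> R \<Longrightarrow> (\<lambda>x. f (\<phi> x)) \<in> reg S (topspace (zar S))"
  shows "morphism S (zariski_space P R) \<phi>"
proof -
  let ?Z = "zariski_space P R"
  have "openin (zar S) (\<phi> -` U \<inter> topspace (zar S))"
    if U: "U \<in> {{x \<in> P. f x \<noteq> 0} |f. f \<in> R}" for U
  proof -
    obtain f where f: "f \<in> R" "U = {x \<in> P. f x \<noteq> 0}" using U by blast
    then have "\<phi> -` U \<inter> topspace (zar S) = {x \<in> topspace (zar S). f (\<phi> x) \<noteq> 0}"
      using into by auto
    then show ?thesis
      using openin_nonzero[OF openin_topspace pull[OF f(1)]] by simp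
  qed
  then have cont: "continuous_map (zar S) (zar ?Z) \<phi>"
    unfolding zar_zariski_space continuous_on_generated_topo_iff
    using into topspace_zariski_space[OF R]
    by (auto simp: zar_zariski_space)
  moreover have "h \<circ> \<phi> \<in> reg S {x \<in> topspace (zar S). \<phi> x \<in> U}"
    if U: "openin (zar ?Z) U" and h: "h \<in> reg ?Z U" for U h
  proof (rule reg_local)
    show "openin (zar S) {x \<in> topspace (zar S). \<phi> x \<in> U}"
      using cont U by (rule openin_continuous_map_preimage)
    fix x assume x: "x \<in> {x \<in> topspace (zar S). \<phi> x \<in> U}"
    then obtain W a b where W: "openin (zar ?Z) W" "\<phi> x \<in> W" "W \<subseteq> U" "a \<in> R" "b \<in> R"
      "\<forall>y\<in>W. b y \<noteq> 0 \<and> h y = a y / b y"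
      using h unfolding reg_zariski_space by auto
    let ?W = "{x \<in> topspace (zar S). \<phi> x \<in> W}"
    have op: "openin (zar S) ?W"
      using cont W(1) by (rule openin_continuous_map_preimage)
    have "(\<lambda>x. a (\<phi> x) / b (\<phi> x)) \<in> reg S ?W"
      using op W by (intro reg_divide reg_subset[OF openin_topspace _ _ pull]) auto
    then have "h \<circ> \<phi> \<in> reg S ?W"
      by (rule reg_cong[OF op]) (use W in auto)
    then show "\<exists>W. openin (zar S) W \<and> x \<in> W \<and> W \<subseteq> {x \<in> topspace (zar S). \<phi> x \<in> U} \<and> h \<circ> \<phi> \<in> reg S W"
      using op W x by (intro exI[of _ ?W]) auto
  qed
  ultimately show ?thesis
    unfolding morphism_def by blast
qed

section \<open>Polynomial functions and their derivatives\<close>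

lemma generated_algebra_sum:
  "(\<And>i. i \<in> I \<Longrightarrow> f i \<in> generated_algebra G) \<Longrightarrow> (\<lambda>x. \<Sum>i\<in>I. f i x) \<in> generated_algebra G"
  by (induction I rule: infinite_finite_induct)
    (auto intro: generated_algebra.const generated_algebra.add)

lemma generated_algebra_power:
  "f \<in> generated_algebra G \<Longrightarrow> (\<lambda>x. f x ^ n) \<in> generated_algebra G"
  by (induction n) (auto intro: generated_algebra.const generated_algebra.mult)

lemma poly_functions_coord: "(\<lambda>x. x $ i) \<in> poly_functions"
  unfolding poly_functions_def by (rule generated_algebra.gen) blast

lemma poly_functions_const: "(\<lambda>_. c) \<in> poly_functions"
  unfolding poly_functions_def by (rule generated_algebra.const)

lemma poly_functions_add:
  "f \<in> poly_functions \<Longrightarrow> g \<in> poly_functions \<Longrightarrow> (\<lambda>x. f x + g x) \<in> poly_functions"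
  unfolding poly_functions_def by (rule generated_algebra.add)

lemma poly_functions_mult:
  "f \<in> poly_functions \<Longrightarrow> g \<in> poly_functions \<Longrightarrow> (\<lambda>x. f x * g x) \<in> poly_functions"
  unfolding poly_functions_def by (rule generated_algebra.mult)

lemma poly_functions_sum:
  "(\<And>i. i \<in> I \<Longrightarrow> f i \<in> poly_functions) \<Longrightarrow> (\<lambda>x. \<Sum>i\<in>I. f i x) \<in> poly_functions"
  unfolding poly_functions_def by (rule generated_algebra_sum)

lemma poly_functions_power:
  "f \<in> poly_functions \<Longrightarrow> (\<lambda>x. f x ^ n) \<in> poly_functions"
  unfolding poly_functions_def by (rule generated_algebra_power)

lemma poly_functions_diff:
  assumes "f \<in> poly_functions" "g \<in> poly_functions"
  shows "(\<lambda>x. f x - g x) \<in> poly_functions"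
  using poly_functions_add[OF assms(1) poly_functions_mult[OF poly_functions_const[of "-1"] assms(2)]]
  by simp

lemmas poly_functions_intros = poly_functions_coord poly_functions_const poly_functions_add
  poly_functions_mult poly_functions_sum poly_functions_power poly_functions_diff

lemma poly_functions_induct [consumes 1, case_names coord const add mult]:
  assumes "f \<in> poly_functions"
    and "\<And>i. P (\<lambda>x. x $ i)" "\<And>c. P (\<lambda>_. c)"
    and "\<And>f g. f \<in> poly_functions \<Longrightarrow> P f \<Longrightarrow> g \<in> poly_functions \<Longrightarrow> P g \<Longrightarrow> P (\<lambda>x. f x + g x)"
    and "\<And>f g. f \<in> poly_functions \<Longrightarrow> P f \<Longrightarrow> g \<in> poly_functions \<Longrightarrow> P g \<Longrightarrow> P (\<lambda>x. f x * g x)"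
  shows "P f"
  using assms(1) unfolding poly_functions_def
proof (induction rule: generated_algebra.induct)
  case (gen f)
  then show ?case using assms(2) by auto
next
  case (const c)
  show ?case by (rule assms(3))
next
  case (add f g)
  show ?case by (rule assms(4)) (use add in \<open>simp_all add: poly_functions_def\<close>)
next
  case (mult f g)
  show ?case by (rule assms(5)) (use mult in \<open>simp_all add: poly_functions_def\<close>)
qed

lemma generated_algebra_poly_comp:
  assumes "f \<in> poly_functions" "\<And>i. (\<lambda>x. F x $ i) \<in> generated_algebra G"
  shows "(\<lambda>x. f (F x)) \<in> generated_algebra G"
  using assms(1)
  by (induction rule: poly_functions_induct) 
    (auto intro: assms(2) generated_algebra.const generated_algebra.add generated_algebra.mult)

lemma poly_functions_comp:
  assumes "f \<in> poly_functions" "\<And>i. (\<lambda>x. F x $ i) \<in> poly_functions"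
  shows "(\<lambda>x. f (F x)) \<in> poly_functions"
  using generated_algebra_poly_comp[OF assms(1)] assms(2) unfolding poly_functions_def by metis

text \<open>
  Reduction to polynomials in one variable; differentiability and the integrality of linear spaces
  both come from here.
\<close>

lemma poly_functions_on_line:
  assumes "f \<in> poly_functions"
  shows "\<exists>p. \<forall>z. f (x + z *s v) = poly p z"
  using assms
proof (induction rule: poly_functions_induct)
  case (coord i)
  show ?case by (rule exI[of _ "[:x $ i, v $ i:]"]) simp
next
  case (const c)
  show ?case by (rule exI[of _ "[:c:]"]) simp
next
  case (add f g)
  then obtain p q where "\<forall>z. f (x + z *s v) = poly p z" "\<forall>z. g (x + z *s v) = poly q z"
    by blast
  then show ?case by (intro exI[of _ "p + q"]) simp
next
  case (mult f g)
  then obtain p q where "\<forall>z. f (x + z *s v) = poly p z" "\<forall>z. g (x + z *s v) = poly q z"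
    by blast
  then show ?case by (intro exI[of _ "p * q"]) simp
qed

lemma has_directional_deriv:
  assumes "f \<in> poly_functions"
  shows "((\<lambda>z. f (x + z *s v)) has_field_derivative directional_deriv f x v) (at 0)"
proof -
  obtain p where "\<And>z. f (x + z *s v) = poly p z"
    using poly_functions_on_line[OF assms] by meson
  then have "(\<lambda>z. f (x + z *s v)) field_differentiable at 0"
    using poly_DERIV[of p 0] unfolding field_differentiable_def by (simp only:) blast
  then show ?thesis
    unfolding directional_deriv_def by (simp add: DERIV_deriv_iff_field_differentiable)
qed

lemma directional_deriv_coord: "directional_deriv (\<lambda>x. x $ i) x v = v $ i"
  unfolding directional_deriv_def
  by (rule DERIV_imp_deriv) (auto intro!: derivative_eq_intros)

lemma directional_deriv_const: "directional_deriv (\<lambda>_. c) x v = 0"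
  unfolding directional_deriv_def by simp

lemma directional_deriv_add:
  assumes "f \<in> poly_functions" "g \<in> poly_functions"
  shows "directional_deriv (\<lambda>x. f x + g x) x v = directional_deriv f x v + directional_deriv g x v"
  using DERIV_add[OF has_directional_deriv[OF assms(1)] has_directional_deriv[OF assms(2)]]
  unfolding directional_deriv_def by (rule DERIV_imp_deriv)

lemma directional_deriv_mult:
  assumes "f \<in> poly_functions" "g \<in> poly_functions"
  shows "directional_deriv (\<lambda>x. f x * g x) x v =
    f x * directional_deriv g x v + directional_deriv f x v * g x"
proof -
  have "((\<lambda>z. f (x + z *s v) * g (x + z *s v)) has_field_derivative
      f x * directional_deriv g x v + directional_deriv f x v * g x) (at 0)"
    using DERIV_mult'[OF has_directional_deriv[OF assms(1)] has_directional_deriv[OF assms(2)],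
        of x v x v] by simp
  then show ?thesis
    unfolding directional_deriv_def[of "\<lambda>x. f x * g x"] by (rule DERIV_imp_deriv)
qed

lemma directional_deriv_sum_scaled:
  assumes "finite I" "\<And>i. i \<in> I \<Longrightarrow> f i \<in> poly_functions"
  shows "directional_deriv (\<lambda>x. \<Sum>i\<in>I. a i * f i x) x v = (\<Sum>i\<in>I. a i * directional_deriv (f i) x v)"
  using assms
  by (induction I)
    (simp_all add: directional_deriv_const directional_deriv_add directional_deriv_mult
      poly_functions_intros)

lemma directional_deriv_diff:
  assumes "f \<in> poly_functions" "g \<in> poly_functions"
  shows "directional_deriv (\<lambda>x. f x - g x) x v = directional_deriv f x v - directional_deriv g x v"
  using DERIV_diff[OF has_directional_deriv[OF assms(1)] has_directional_deriv[OF assms(2)]]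
  unfolding directional_deriv_def by (rule DERIV_imp_deriv)

text \<open>
  The coefficients \<open>a\<close> form the gradient. Linearity in the direction makes tangent spaces algebraic
  sets and the linearised action algebraic.
\<close>

lemma directional_deriv_linear:
  assumes "f \<in> poly_functions"
  shows "\<exists>a. \<forall>v. directional_deriv f x v = (\<Sum>i\<in>UNIV. a i * v $ i)"
  using assms
proof (induction rule: poly_functions_induct)
  case (coord i)
  show ?case
    by (rule exI[of _ "\<lambda>j. if j = i then 1 else 0"])
      (simp add: directional_deriv_coord if_distrib[of "\<lambda>c. c * _"] cong: if_cong)
next
  case (const c)
  show ?case by (rule exI[of _ "\<lambda>_. 0"]) (simp add: directional_deriv_const)
next
  case (add f g)
  then obtain a b where "\<forall>v. directional_deriv f x v = (\<Sum>i\<in>UNIV. a i * v $ i)"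
    "\<forall>v. directional_deriv g x v = (\<Sum>i\<in>UNIV. b i * v $ i)"
    by blast
  then show ?case
    by (intro exI[of _ "\<lambda>i. a i + b i"])
      (simp add: directional_deriv_add add.hyps algebra_simps sum.distrib)
next
  case (mult f g)
  then obtain a b where "\<forall>v. directional_deriv f x v = (\<Sum>i\<in>UNIV. a i * v $ i)"
    "\<forall>v. directional_deriv g x v = (\<Sum>i\<in>UNIV. b i * v $ i)"
    by blast
  then show ?case
    by (intro exI[of _ "\<lambda>i. g x * a i + f x * b i"])
      (simp add: directional_deriv_mult mult.hyps algebra_simps sum.distrib sum_distrib_left)
qed

lemma poly_functions_directional_deriv:
  assumes "f \<in> poly_functions"
  shows "(\<lambda>v. directional_deriv f x v) \<in> poly_functions"
proof -
  obtain a where "\<forall>v. directional_deriv f x v = (\<Sum>i\<in>UNIV. a i * v $ i)"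
    using directional_deriv_linear[OF assms] by blast
  then show ?thesis
    by (auto intro!: poly_functions_intros)
qed

lemma directional_deriv_comp:
  assumes "f \<in> poly_functions" and F: "\<And>i. (\<lambda>x. F x $ i) \<in> poly_functions"
  shows "directional_deriv (\<lambda>x. f (F x)) x v =
    directional_deriv f (F x) (\<chi> i. directional_deriv (\<lambda>x. F x $ i) x v)"
  using assms(1)
  by (induction rule: poly_functions_induct)
    (simp_all add: directional_deriv_coord directional_deriv_const directional_deriv_add
      directional_deriv_mult poly_functions_comp F)

section \<open>Laurent polynomials with coefficients in an algebra of functions\<close>

text \<open>
  Multiplied by a power of \<open>t\<close>, the sum becomes a polynomial with infinitely many roots.
\<close>

lemma laurent_coeffs_zero:
  fixes a :: "int \<Rightarrow> complex"
  assumes K: "finite K" and zero: "\<And>t. t \<noteq> 0 \<Longrightarrow> (\<Sum>n\<in>K. t powi n * a n) = 0" and n: "n \<in> K"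
  shows "a n = 0"
proof -
  define m where "m = Min K"
  have m: "m \<le> k" if "k \<in> K" for k
    using K that by (simp add: m_def)
  define p where "p = (\<Sum>k\<in>K. monom (a k) (nat (k - m)))"
  have "poly p t = 0" if "t \<noteq> 0" for t
  proof -
    have "poly p t = (\<Sum>k\<in>K. t powi (- m) * (t powi k * a k))"
      unfolding p_def poly_sum
    proof (rule sum.cong)
      fix k assume k: "k \<in> K"
      have "t ^ nat (k - m) = t powi (k - m)"
        using m[OF k] by (simp add: power_int_def)
      then show "poly (monom (a k) (nat (k - m))) t = t powi (- m) * (t powi k * a k)"
        using that by (simp add: poly_monom power_int_diff power_int_minus field_simps)
    qed simp
    then show ?thesis
      using zero[OF that] by (simp flip: sum_distrib_left)
  qed
  then have "UNIV - {0} \<subseteq> {t. poly p t = 0}"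
    by auto
  moreover have "infinite (UNIV - {0 :: complex})"
    using infinite_UNIV_char_0 by (simp add: infinite_remove)
  ultimately have "p = 0"
    using poly_roots_finite finite_subset by blast
  then have "0 = coeff p (nat (n - m))"
    by simp
  also have "\<dots> = (\<Sum>k\<in>K. if k = n then a k else 0)"
    unfolding p_def coeff_sum
  proof (rule sum.cong)
    fix k assume "k \<in> K"
    then have "nat (k - m) = nat (n - m) \<longleftrightarrow> k = n"
      using m[OF \<open>k \<in> K\<close>] m[OF n] by auto
    then show "coeff (monom (a k) (nat (k - m))) (nat (n - m)) = (if k = n then a k else 0)"
      by simp
  qed simp
  also have "\<dots> = a n"
    using K n by simp
  finally show ?thesis by simp
qed

text \<open>
  Two instances are used: polynomial coefficients, for the coordinates of an action, and fractions of
  invariants as coefficients, for the localised coordinate ring of a variety with an action.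
\<close>

definition laurent_over :: "'y set \<Rightarrow> ('y \<Rightarrow> complex) set \<Rightarrow> (complex \<Rightarrow> 'y \<Rightarrow> complex) set" where
  "laurent_over D C = {F. \<exists>K c. finite K \<and> (\<forall>n. c n \<in> C) \<and>
     (\<forall>t y. t \<noteq> 0 \<longrightarrow> y \<in> D \<longrightarrow> F t y = (\<Sum>n\<in>K. t powi n * c n y))}"

lemma laurent_overD:
  assumes "F \<in> laurent_over D C"
  shows "\<exists>K c. finite K \<and> (\<forall>n. c n \<in> C) \<and>
     (\<forall>t y. t \<noteq> 0 \<longrightarrow> y \<in> D \<longrightarrow> F t y = (\<Sum>n\<in>K. t powi n * c n y))"
  using assms by (simp add: laurent_over_def)

lemma laurent_overI:
  assumes "finite K" "\<And>n::int. c n \<in> C"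
    "\<And>t y. t \<noteq> 0 \<Longrightarrow> y \<in> D \<Longrightarrow> F t y = (\<Sum>n\<in>K. t powi n * c n y)"
  shows "F \<in> laurent_over D C"
  unfolding laurent_over_def using assms by (intro CollectI exI[of _ K] exI[of _ c]) simp

locale coefficient_algebra =
  fixes C :: "('y \<Rightarrow> complex) set" and D :: "'y set"
  assumes const_mem: "(\<lambda>_. a) \<in> C"
    and add_mem: "\<lbrakk>f \<in> C; g \<in> C\<rbrakk> \<Longrightarrow> (\<lambda>y. f y + g y) \<in> C"
    and mult_mem: "\<lbrakk>f \<in> C; g \<in> C\<rbrakk> \<Longrightarrow> (\<lambda>y. f y * g y) \<in> C"
begin

lemma laurent_monomial: "c \<in> C \<Longrightarrow> (\<lambda>t y. t powi n * c y) \<in> laurent_over D C"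
  by (rule laurent_overI[of "{n}" "\<lambda>_. c"]) simp_all

lemma laurent_coeff: "c \<in> C \<Longrightarrow> (\<lambda>t y. c y) \<in> laurent_over D C"
  using laurent_monomial[of c 0] by simp

lemma laurent_cong:
  assumes "F \<in> laurent_over D C" "\<And>t y. t \<noteq> 0 \<Longrightarrow> y \<in> D \<Longrightarrow> G t y = F t y"
  shows "G \<in> laurent_over D C"
  using assms by (simp add: laurent_over_def)

lemma laurent_add:
  assumes "F \<in> laurent_over D C" "G \<in> laurent_over D C"
  shows "(\<lambda>t y. F t y + G t y) \<in> laurent_over D C"
proof -
  obtain K a where F: "finite K" "\<And>n. a n \<in> C"
    "\<And>t y. t \<noteq> 0 \<Longrightarrow> y \<in> D \<Longrightarrow> F t y = (\<Sum>n\<in>K. t powi n * a n y)"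
    using laurent_overD[OF assms(1)] by meson
  obtain L b where G: "finite L" "\<And>n. b n \<in> C"
    "\<And>t y. t \<noteq> 0 \<Longrightarrow> y \<in> D \<Longrightarrow> G t y = (\<Sum>n\<in>L. t powi n * b n y)"
    using laurent_overD[OF assms(2)] by meson
  show ?thesis
  proof (rule laurent_overI)
    let ?c = "\<lambda>n y. (if n \<in> K then a n y else 0) + (if n \<in> L then b n y else 0)"
    show "finite (K \<union> L)" using F G by simp
    show "?c n \<in> C" for n
      using F(2)[of n] G(2)[of n] const_mem[of 0]
      by (cases "n \<in> K"; cases "n \<in> L"; intro add_mem; simp)
    fix t :: complex and y assume *: "t \<noteq> 0" "y \<in> D"
    have "(\<Sum>n\<in>K. t powi n * a n y) = (\<Sum>n\<in>K \<union> L. t powi n * (if n \<in> K then a n y else 0))"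
      "(\<Sum>n\<in>L. t powi n * b n y) = (\<Sum>n\<in>K \<union> L. t powi n * (if n \<in> L then b n y else 0))"
      using F(1) G(1) by (intro sum.mono_neutral_cong_left; auto)+
    then show "F t y + G t y = (\<Sum>n\<in>K \<union> L. t powi n * ?c n y)"
      by (simp add: F(3)[OF *] G(3)[OF *] distrib_left sum.distrib)
  qed
qed

lemma laurent_sum:
  "(\<And>i. i \<in> I \<Longrightarrow> F i \<in> laurent_over D C) \<Longrightarrow> (\<lambda>t y. \<Sum>i\<in>I. F i t y) \<in> laurent_over D C"
  by (induction I rule: infinite_finite_induct) (auto intro: laurent_add laurent_coeff const_mem)

lemma laurent_mult:
  assumes "F \<in> laurent_over D C" "G \<in> laurent_over D C"
  shows "(\<lambda>t y. F t y * G t y) \<in> laurent_over D C"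
proof -
  obtain K a where F: "finite K" "\<And>n. a n \<in> C"
    "\<And>t y. t \<noteq> 0 \<Longrightarrow> y \<in> D \<Longrightarrow> F t y = (\<Sum>n\<in>K. t powi n * a n y)"
    using laurent_overD[OF assms(1)] by meson
  obtain L b where G: "finite L" "\<And>n. b n \<in> C"
    "\<And>t y. t \<noteq> 0 \<Longrightarrow> y \<in> D \<Longrightarrow> G t y = (\<Sum>n\<in>L. t powi n * b n y)"
    using laurent_overD[OF assms(2)] by meson
  have "(\<lambda>t y. \<Sum>n\<in>K. \<Sum>m\<in>L. t powi (n + m) * (a n y * b m y)) \<in> laurent_over D C"
    by (intro laurent_sum laurent_monomial mult_mem F G)
  then show ?thesis
    by (rule laurent_cong)
      (simp add: F(3) G(3) sum_product power_int_add algebra_simps)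
qed

lemma laurent_poly_comp:
  assumes "f \<in> poly_functions" "\<And>i. (\<lambda>t y. S t y $ i) \<in> laurent_over D C"
  shows "(\<lambda>t y. f (S t y)) \<in> laurent_over D C"
  using assms(1)
  by (induction rule: poly_functions_induct)
    (auto intro: assms(2) laurent_coeff const_mem laurent_add laurent_mult)

end

lemma coefficient_algebra_poly_functions: "coefficient_algebra poly_functions"
  by unfold_locales (intro poly_functions_intros; assumption)+

text \<open>
  Applied to the coordinates of an action, this is the source of the weight decomposition.
\<close>

lemma laurent_poly_functions_decompose:
  assumes "h \<in> laurent_poly_functions"
  shows "(\<lambda>t x. h (t, x)) \<in> laurent_over UNIV poly_functions"
proof -
  interpret coefficient_algebra poly_functions UNIV
    by (rule coefficient_algebra_poly_functions)
  show ?thesis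
    using assms unfolding laurent_poly_functions_def
  proof (induction rule: generated_algebra.induct)
    case (gen f)
    then consider "f = (\<lambda>(t, x). t)" | "f = (\<lambda>(t, x). inverse t)" | i where "f = (\<lambda>(t, x). x $ i)"
      by auto
    then show ?case
    proof cases
      case 1
      then show ?thesis
        using laurent_monomial[OF poly_functions_const[of 1], of 1] by simp
    next
      case 2
      then show ?thesis
        using laurent_monomial[OF poly_functions_const[of 1], of "-1"] by simp
    next
      case (3 i)
      then show ?thesis
        using laurent_coeff[OF poly_functions_coord[of i]] by simp
    qed
  next
    case (const c)
    show ?case by (intro laurent_coeff poly_functions_const)
  qed (auto intro: laurent_add laurent_mult)
qed

lemma laurent_poly_functions_if_decomposed:
  fixes c :: "int \<Rightarrow> complex ^ 'n \<Rightarrow> complex"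
  assumes "finite K" "\<And>n. n \<in> K \<Longrightarrow> c n \<in> poly_functions"
  shows "(\<lambda>(t, x). \<Sum>n\<in>K. t powi n * c n x) \<in> laurent_poly_functions"
proof -
  let ?G = "{\<lambda>(t, x). t, \<lambda>(t, x). inverse t} \<union> range (\<lambda>i (t, x). x $ i) ::
    (complex \<times> (complex ^ 'n) \<Rightarrow> complex) set"
  have pow: "(\<lambda>(t, x). t powi n) \<in> generated_algebra ?G" for n
  proof (cases "n \<ge> 0")
    case True
    have "(\<lambda>(t, x). t) \<in> generated_algebra ?G"
      by (rule generated_algebra.gen) blast
    from generated_algebra_power[OF this, of "nat n"] show ?thesis
      using True by (simp add: power_int_def case_prod_unfold)
  next
    case False
    have "(\<lambda>(t, x). inverse t) \<in> generated_algebra ?G"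
      by (rule generated_algebra.gen) blast
    from generated_algebra_power[OF this, of "nat (- n)"] show ?thesis
      using False by (simp add: power_int_def case_prod_unfold)
  qed
  have pol: "(\<lambda>(t, x). c n x) \<in> generated_algebra ?G" if "n \<in> K" for n
  proof -
    have "(\<lambda>y. snd y $ i) \<in> generated_algebra ?G" for i
      by (rule generated_algebra.gen) (auto simp: case_prod_unfold)
    from generated_algebra_poly_comp[OF assms(2)[OF that] this] show ?thesis
      by (simp add: case_prod_unfold)
  qed
  have "(\<lambda>y. \<Sum>n\<in>K. (\<lambda>(t, x). t powi n) y * (\<lambda>(t, x). c n x) y) \<in> generated_algebra ?G"
    by (intro generated_algebra_sum generated_algebra.mult pow pol)
  then show ?thesis
    unfolding laurent_poly_functions_def by (simp add: case_prod_unfold)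
qed

section \<open>Algebras of functions and their characters\<close>

text \<open>
  Closure under the operations as they occur in \<open>algebra_characters\<close>, which restrict every result
  to \<open>X\<close> again.
\<close>

definition restricted_algebra :: "'a set \<Rightarrow> ('a \<Rightarrow> complex) set \<Rightarrow> bool" where
  "restricted_algebra X A \<longleftrightarrow> (\<forall>c. (\<lambda>x\<in>X. c) \<in> A) \<and>
     (\<forall>f\<in>A. \<forall>g\<in>A. (\<lambda>x\<in>X. f x + g x) \<in> A \<and> (\<lambda>x\<in>X. f x * g x) \<in> A)"

text \<open>
  The quotient morphism from a variety to the spectrum of an algebra \<open>A\<close> of functions on it.
\<close>

definition evaluation :: "('a \<Rightarrow> complex) set \<Rightarrow> 'a \<Rightarrow> ('a \<Rightarrow> complex) \<Rightarrow> complex" where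
  "evaluation A x = (\<lambda>f\<in>A. f x)"

lemma evaluation_apply [simp]: "f \<in> A \<Longrightarrow> evaluation A x f = f x"
  by (simp add: evaluation_def)

lemma evaluation_in_characters:
  assumes "restricted_algebra X A" "x \<in> X"
  shows "evaluation A x \<in> algebra_characters X A"
  using assms by (auto simp: algebra_characters_def evaluation_def restricted_algebra_def)

lemma
  assumes "\<xi> \<in> algebra_characters X A"
  shows character_const: "\<xi> (\<lambda>x\<in>X. c) = c"
    and character_add: "f \<in> A \<Longrightarrow> g \<in> A \<Longrightarrow> \<xi> (\<lambda>x\<in>X. f x + g x) = \<xi> f + \<xi> g"
    and character_mult: "f \<in> A \<Longrightarrow> g \<in> A \<Longrightarrow> \<xi> (\<lambda>x\<in>X. f x * g x) = \<xi> f * \<xi> g"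
    and character_extensional: "\<xi> \<in> extensional A"
  using assms by (simp_all add: algebra_characters_def)

lemma function_algebra_characters:
  assumes "restricted_algebra X A"
  shows "function_algebra (algebra_characters X A) ((\<lambda>f \<xi>. \<xi> f) ` A)"
  unfolding function_algebra_def
proof (intro conjI allI ballI)
  fix c
  show "\<exists>k\<in>(\<lambda>f \<xi>. \<xi> f) ` A. \<forall>x\<in>algebra_characters X A. k x = c"
    using assms by (intro bexI[of _ "\<lambda>\<xi>. \<xi> (\<lambda>x\<in>X. c)"])
      (auto simp: character_const restricted_algebra_def)
next
  fix f' g' :: "(('a \<Rightarrow> complex) \<Rightarrow> complex) \<Rightarrow> complex"
  assume "f' \<in> (\<lambda>f \<xi>. \<xi> f) ` A" "g' \<in> (\<lambda>f \<xi>. \<xi> f) ` A"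
  then obtain f g where f: "f \<in> A" "f' = (\<lambda>\<xi>. \<xi> f)" and g: "g \<in> A" "g' = (\<lambda>\<xi>. \<xi> g)"
    by auto
  show "\<exists>k\<in>(\<lambda>f \<xi>. \<xi> f) ` A. \<forall>x\<in>algebra_characters X A. k x = f' x + g' x"
    using assms f g by (intro bexI[of _ "\<lambda>\<xi>. \<xi> (\<lambda>x\<in>X. f x + g x)"])
      (auto simp: character_add restricted_algebra_def)
  show "\<exists>k\<in>(\<lambda>f \<xi>. \<xi> f) ` A. \<forall>x\<in>algebra_characters X A. k x = f' x * g' x"
    using assms f g by (intro bexI[of _ "\<lambda>\<xi>. \<xi> (\<lambda>x\<in>X. f x * g x)"])
      (auto simp: character_mult restricted_algebra_def)
qed

definition principal_characters ::
  "'a set \<Rightarrow> ('a \<Rightarrow> complex) set \<Rightarrow> ('a \<Rightarrow> complex) \<Rightarrow> (('a \<Rightarrow> complex) \<Rightarrow> complex) set" where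
  "principal_characters X A g = {\<xi> \<in> algebra_characters X A. \<xi> g \<noteq> 0}"

text \<open>
  The localisation of \<open>A\<close> at \<open>g\<close>, realised as functions on the principal open subset of the
  spectrum.
\<close>

definition fractions ::
  "'a set \<Rightarrow> ('a \<Rightarrow> complex) set \<Rightarrow> ('a \<Rightarrow> complex) \<Rightarrow> ((('a \<Rightarrow> complex) \<Rightarrow> complex) \<Rightarrow> complex) set" where
  "fractions X A g = {\<beta>. \<exists>c\<in>A. \<exists>N. \<forall>\<xi>\<in>principal_characters X A g. \<beta> \<xi> = \<xi> c / \<xi> g ^ N}"

lemma restricted_algebra_power:
  assumes A: "restricted_algebra X A" and "g \<in> A"
  shows "(\<lambda>x\<in>X. g x ^ n) \<in> A"
    and "\<xi> \<in> algebra_characters X A \<Longrightarrow> \<xi> (\<lambda>x\<in>X. g x ^ n) = \<xi> g ^ n"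
proof (induction n)
  case 0
  {
    case 1
    show ?case using A unfolding restricted_algebra_def power_0 by meson
  next
    case 2
    then show ?case unfolding power_0 by (rule character_const)
  }
next
  case (Suc n)
  have eq: "(\<lambda>x\<in>X. g x ^ Suc n) = (\<lambda>x\<in>X. g x * (\<lambda>x\<in>X. g x ^ n) x)"
    by (auto simp: restrict_def)
  {
    case 1
    show ?case
      unfolding eq using A Suc(1) assms(2) unfolding restricted_algebra_def by metis
  next
    case 2
    have "\<xi> (\<lambda>x\<in>X. g x ^ Suc n) = \<xi> g * \<xi> (\<lambda>x\<in>X. g x ^ n)"
      unfolding eq by (rule character_mult[OF 2 assms(2) Suc(1)])
    also have "\<dots> = \<xi> g ^ Suc n"
      by (simp only: Suc(2)[OF 2] power_Suc)
    finally show ?case .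
  }
qed

lemma coefficient_algebra_fractions:
  assumes A: "restricted_algebra X A" and g: "g \<in> A"
  shows "coefficient_algebra (fractions X A g)"
proof
  let ?D = "principal_characters X A g"
  show "(\<lambda>_. a) \<in> fractions X A g" for a
    unfolding fractions_def using A
    by (intro CollectI bexI[of _ "\<lambda>x\<in>X. a"] exI[of _ 0])
      (auto simp: restricted_algebra_def principal_characters_def character_const)
  fix \<beta> \<gamma> assume "\<beta> \<in> fractions X A g" "\<gamma> \<in> fractions X A g"
  then obtain b c N M where b: "b \<in> A" "\<forall>\<xi>\<in>?D. \<beta> \<xi> = \<xi> b / \<xi> g ^ N"
    and c: "c \<in> A" "\<forall>\<xi>\<in>?D. \<gamma> \<xi> = \<xi> c / \<xi> g ^ M"
    unfolding fractions_def mem_Collect_eq by metis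
  have D: "\<xi> \<in> algebra_characters X A" "\<xi> g \<noteq> 0" if "\<xi> \<in> ?D" for \<xi>
    using that by (auto simp: principal_characters_def)
  have mult: "(\<lambda>x\<in>X. f x * h x) \<in> A" if "f \<in> A" "h \<in> A" for f h
    using A that by (auto simp: restricted_algebra_def)
  show "(\<lambda>\<xi>. \<beta> \<xi> * \<gamma> \<xi>) \<in> fractions X A g"
    unfolding fractions_def
  proof (intro CollectI bexI exI ballI)
    show "(\<lambda>x\<in>X. b x * c x) \<in> A" by (intro mult b c)
    fix \<xi> assume \<xi>: "\<xi> \<in> ?D"
    show "\<beta> \<xi> * \<gamma> \<xi> = \<xi> (\<lambda>x\<in>X. b x * c x) / \<xi> g ^ (N + M)"
      using b c D[OF \<xi>] \<xi> by (simp add: character_mult power_add)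
  qed
  let ?g = "\<lambda>n. \<lambda>x\<in>X. g x ^ n"
  let ?b = "\<lambda>x\<in>X. b x * ?g M x" and ?c = "\<lambda>x\<in>X. c x * ?g N x"
  have g': "?g n \<in> A" for n
    using A g by (rule restricted_algebra_power)
  show "(\<lambda>\<xi>. \<beta> \<xi> + \<gamma> \<xi>) \<in> fractions X A g"
    unfolding fractions_def
  proof (intro CollectI bexI exI ballI)
    show "(\<lambda>x\<in>X. ?b x + ?c x) \<in> A"
      using A mult[OF b(1) g', of M] mult[OF c(1) g', of N] by (simp only: restricted_algebra_def)
    fix \<xi> assume \<xi>: "\<xi> \<in> ?D"
    have "\<xi> (\<lambda>x\<in>X. ?b x + ?c x) = \<xi> b * \<xi> g ^ M + \<xi> c * \<xi> g ^ N"
      using D[OF \<xi>] mult[OF b(1) g', of M] mult[OF c(1) g', of N] b(1) c(1) g'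
      by (simp only: character_add character_mult restricted_algebra_power(2)[OF A g])
    then show "\<beta> \<xi> + \<gamma> \<xi> = \<xi> (\<lambda>x\<in>X. ?b x + ?c x) / \<xi> g ^ (N + M)"
      using b c D[OF \<xi>] \<xi> by (simp add: field_simps power_add)
  qed
qed

section \<open>Splitting off the multiplicative group\<close>

text \<open>
  The coordinate ring of \<open>X\<close> has no zero divisors; formulated with polynomials on the ambient space
  in order to avoid restrictions.
\<close>

definition integral_on :: "(complex ^ 'n) set \<Rightarrow> bool" where
  "integral_on X \<longleftrightarrow> (\<forall>f\<in>poly_functions. \<forall>g\<in>poly_functions.
     (\<forall>x\<in>X. f x * g x = 0) \<longrightarrow> (\<forall>x\<in>X. f x = 0) \<or> (\<forall>x\<in>X. g x = 0))"

definition semi_invariants ::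
  "(complex ^ 'n) set \<Rightarrow> (complex \<Rightarrow> complex ^ 'n \<Rightarrow> complex ^ 'n) \<Rightarrow> int \<Rightarrow>
    (complex ^ 'n \<Rightarrow> complex) set" where
  "semi_invariants X \<sigma> n =
     {f \<in> poly_functions. \<forall>t x. t \<noteq> 0 \<longrightarrow> x \<in> X \<longrightarrow> f (\<sigma> t x) = t powi n * f x}"

lemma integral_on_mult:
  assumes "integral_on X" "f \<in> poly_functions" "g \<in> poly_functions"
    and "\<exists>x\<in>X. f x \<noteq> 0" "\<exists>x\<in>X. g x \<noteq> 0"
  shows "\<exists>x\<in>X. f x * g x \<noteq> 0"
proof -
  have "(\<forall>x\<in>X. f x * g x = 0) \<longrightarrow> (\<forall>x\<in>X. f x = 0) \<or> (\<forall>x\<in>X. g x = 0)"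
    by (rule assms(1)[unfolded integral_on_def, THEN bspec, OF assms(2), THEN bspec, OF assms(3)])
  then show ?thesis
    using assms(4,5) by auto
qed

lemma semi_invariants_poly: "f \<in> semi_invariants X \<sigma> n \<Longrightarrow> f \<in> poly_functions"
  by (simp add: semi_invariants_def)

lemma semi_invariants_mult:
  "f \<in> semi_invariants X \<sigma> m \<Longrightarrow> g \<in> semi_invariants X \<sigma> n \<Longrightarrow>
    (\<lambda>x. f x * g x) \<in> semi_invariants X \<sigma> (m + n)"
  by (auto simp: semi_invariants_def power_int_add intro: poly_functions_mult)

lemma semi_invariants_power:
  "f \<in> semi_invariants X \<sigma> m \<Longrightarrow> (\<lambda>x. f x ^ k) \<in> semi_invariants X \<sigma> (int k * m)"
proof (induction k)
  case 0
  show ?case by (simp add: semi_invariants_def poly_functions_const)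
next
  case (Suc k)
  then show ?case
    using semi_invariants_mult[OF Suc(2) Suc(1)[OF Suc(2)]] by (simp add: algebra_simps)
qed

lemma restricted_algebra_invariant_ring: "restricted_algebra X (invariant_ring X \<sigma>)"
  if act: "\<And>t x. t \<noteq> 0 \<Longrightarrow> x \<in> X \<Longrightarrow> \<sigma> t x \<in> X"
  unfolding restricted_algebra_def
proof (intro conjI allI ballI)
  fix c
  have "(\<lambda>x\<in>X. c) \<in> coordinate_ring X"
    unfolding coordinate_ring_def using poly_functions_const by blast
  then show "(\<lambda>x\<in>X. c) \<in> invariant_ring X \<sigma>"
    using act by (simp add: invariant_ring_def)
next
  fix f g assume fg: "f \<in> invariant_ring X \<sigma>" "g \<in> invariant_ring X \<sigma>"
  then obtain p q where pq: "p \<in> poly_functions" "f = restrict p X" "q \<in> poly_functions" "g = restrict q X"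
    unfolding invariant_ring_def coordinate_ring_def by blast
  have "(\<lambda>x\<in>X. f x + g x) = restrict (\<lambda>x. p x + q x) X" "(\<lambda>x\<in>X. f x * g x) = restrict (\<lambda>x. p x * q x) X"
    using pq by (auto simp: restrict_def)
  then have "(\<lambda>x\<in>X. f x + g x) \<in> coordinate_ring X" "(\<lambda>x\<in>X. f x * g x) \<in> coordinate_ring X"
    unfolding coordinate_ring_def using poly_functions_add poly_functions_mult pq by blast+
  then show "(\<lambda>x\<in>X. f x + g x) \<in> invariant_ring X \<sigma>" "(\<lambda>x\<in>X. f x * g x) \<in> invariant_ring X \<sigma>"
    using act fg by (simp_all add: invariant_ring_def)
qed

lemma restrict_in_invariant_ring:
  assumes "\<And>t x. t \<noteq> 0 \<Longrightarrow> x \<in> X \<Longrightarrow> \<sigma> t x \<in> X" "f \<in> semi_invariants X \<sigma> 0"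
  shows "restrict f X \<in> invariant_ring X \<sigma>"
  using assms by (auto simp: semi_invariants_def invariant_ring_def coordinate_ring_def)

lemma invariant_ringE:
  assumes "f \<in> invariant_ring X \<sigma>"
  shows "\<exists>p. p \<in> poly_functions \<and> (\<forall>x\<in>X. f x = p x)"
  using assms by (auto simp: invariant_ring_def coordinate_ring_def)

text \<open>
  With elements of both signs at hand, \<open>- n\<close> is a combination with nonnegative coefficients of \<open>n\<close>
  and an element of the opposite sign. Hence \<open>M\<close> is a subgroup, generated by its least positive
  element.
\<close>

lemma additive_int_set_multiples:
  fixes M :: "int set"
  assumes add: "\<And>m n. m \<in> M \<Longrightarrow> n \<in> M \<Longrightarrow> m + n \<in> M"
    and pos: "p \<in> M" "p > 0" and neg: "q \<in> M" "q < 0"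
  shows "\<exists>d>0. d \<in> M \<and> - d \<in> M \<and> (\<forall>n\<in>M. d dvd n)"
proof -
  have mult1: "int (Suc k) * n \<in> M" if "n \<in> M" for n k
  proof (induction k)
    case (Suc k)
    have "int (Suc (Suc k)) * n = int (Suc k) * n + n" by (simp add: algebra_simps)
    then show ?case using add[OF Suc that] by simp
  qed (use that in simp)
  have mult: "k * n \<in> M" if "n \<in> M" "k > 0" for n k
    using mult1[OF that(1), of "nat k - 1"] that(2) by simp
  have zero: "0 \<in> M"
    using add[OF mult[OF pos(1), of "- q"] mult[OF neg(1), of p]] pos neg by simp
  have mult0: "k * n \<in> M" if "n \<in> M" "k \<ge> 0" for n k
    using mult[OF that(1)] zero that(2) by (cases "k = 0") auto
  have minus: "- n \<in> M" if "n \<in> M" for n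
  proof (cases "n \<ge> 0")
    case True
    have "(- q - 1) * n + n * q \<in> M"
      using True neg that by (intro add mult0) auto
    then show ?thesis by (simp add: algebra_simps)
  next
    case False
    have "(p - 1) * n + (- n) * p \<in> M"
      using False pos that by (intro add mult0) auto
    then show ?thesis by (simp add: algebra_simps)
  qed
  have multz: "k * n \<in> M" if "n \<in> M" for n k
    using mult0[OF that, of k] minus[OF mult0[OF that, of "- k"]] by (cases "k \<ge> 0") auto
  define d where "d = int (LEAST k. k > 0 \<and> int k \<in> M)"
  have ex: "nat p > 0 \<and> int (nat p) \<in> M"
    using pos by simp
  have d: "d > 0" "d \<in> M"
    using LeastI[of "\<lambda>k. k > 0 \<and> int k \<in> M", OF ex] by (auto simp: d_def)
  have least: "d \<le> k" if "k > 0" "k \<in> M" for k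
    using Least_le[of "\<lambda>k. k > 0 \<and> int k \<in> M" "nat k"] that by (auto simp: d_def)
  have "d dvd n" if "n \<in> M" for n
  proof -
    have "n + (- (n div d)) * d \<in> M"
      using that d(2) by (intro add multz)
    also have "n + (- (n div d)) * d = n mod d"
      by (simp add: minus_div_mult_eq_mod)
    finally have "n mod d \<in> M" .
    moreover have "0 \<le> n mod d" "n mod d < d"
      using d(1) by simp_all
    ultimately have "n mod d = 0"
      using least[of "n mod d"] by linarith
    then show ?thesis by auto
  qed
  then show ?thesis
    using d minus by blast
qed

text \<open>
  The coefficient of \<open>t\<^sup>n\<close> in a coordinate of \<open>\<sigma> t x\<close> is homogeneous of weight \<open>n\<close>, as comparing
  the coefficients of \<open>t\<^sup>n\<close> in \<open>\<sigma> (t s) x = \<sigma> t (\<sigma> s x)\<close> shows.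
\<close>

lemma action_coordinate_decomposition:
  assumes act: "algebraic_Gm_action X \<sigma>"
  shows "\<exists>K c. finite K \<and> (\<forall>n\<in>K. c n \<in> semi_invariants X \<sigma> n) \<and>
    (\<forall>t x. t \<noteq> 0 \<longrightarrow> x \<in> X \<longrightarrow> \<sigma> t x $ i = (\<Sum>n\<in>K. t powi n * c n x))"
proof -
  have into: "\<sigma> t x \<in> X" if "t \<noteq> 0" "x \<in> X" for t x
    using act that by (simp add: algebraic_Gm_action_def)
  have comp: "\<sigma> (s * t) x = \<sigma> s (\<sigma> t x)" if "s \<noteq> 0" "t \<noteq> 0" "x \<in> X" for s t x
    using act that by (simp add: algebraic_Gm_action_def)
  obtain h where h: "h \<in> laurent_poly_functions" "\<And>t x. t \<noteq> 0 \<Longrightarrow> x \<in> X \<Longrightarrow> \<sigma> t x $ i = h (t, x)"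
    using act unfolding algebraic_Gm_action_def by meson
  obtain K c where K: "finite K" and c: "\<And>n::int. c n \<in> poly_functions"
    and h_eq: "\<And>t x. t \<noteq> 0 \<Longrightarrow> x \<in> UNIV \<Longrightarrow> h (t, x) = (\<Sum>n\<in>K. t powi n * c n x)"
    using laurent_overD[OF laurent_poly_functions_decompose[OF h(1)]] by meson
  have \<sigma>_eq: "\<sigma> t x $ i = (\<Sum>n\<in>K. t powi n * c n x)" if "t \<noteq> 0" "x \<in> X" for t x
    using h(2) h_eq that by simp
  have semi: "c n \<in> semi_invariants X \<sigma> n" if n: "n \<in> K" for n
  proof -
    have "c n (\<sigma> s x) = s powi n * c n x" if s: "s \<noteq> 0" and x: "x \<in> X" for s x
    proof -
      have "c n (\<sigma> s x) - s powi n * c n x = 0"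
      proof (rule laurent_coeffs_zero[OF K _ n])
        fix t :: complex assume t: "t \<noteq> 0"
        have "(\<Sum>n\<in>K. t powi n * c n (\<sigma> s x)) = (\<Sum>n\<in>K. (t * s) powi n * c n x)"
          using \<sigma>_eq[OF t into[OF s x]] \<sigma>_eq[of "t * s" x] comp[OF t s x] t s x by simp
        then show "(\<Sum>n\<in>K. t powi n * (c n (\<sigma> s x) - s powi n * c n x)) = 0"
          by (simp add: right_diff_distrib sum_subtractf power_int_mult_distrib mult.assoc)
      qed
      then show ?thesis by simp
    qed
    then show ?thesis using c by (simp add: semi_invariants_def)
  qed
  show ?thesis
    using K semi \<sigma>_eq by (intro exI[of _ K] exI[of _ c]) simp
qed

text \<open>
  The map \<open>x \<mapsto> (u x, evaluation B x)\<close> identifies the part \<open>g \<noteq> 0\<close> of \<open>X\<close> with the product of the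
  multiplicative group and the part \<open>g \<noteq> 0\<close> of the quotient. Its inverse \<open>S\<close> is algebraic, being
  given by Laurent polynomials in \<open>t\<close> whose coefficients are regular on that part of the quotient.
\<close>

definition quotient_splitting ::
  "(complex ^ 'n) set \<Rightarrow> (complex \<Rightarrow> complex ^ 'n \<Rightarrow> complex ^ 'n) \<Rightarrow> (complex ^ 'n \<Rightarrow> complex) \<Rightarrow>
    (complex ^ 'n \<Rightarrow> complex) \<Rightarrow>
    (complex \<Rightarrow> ((complex ^ 'n \<Rightarrow> complex) \<Rightarrow> complex) \<Rightarrow> complex ^ 'n) \<Rightarrow> bool" where
  "quotient_splitting X \<sigma> g u S \<longleftrightarrow>
     (let B = invariant_ring X \<sigma>; D = principal_characters X B g in
      g \<in> B \<and> (\<exists>x\<in>X. g x \<noteq> 0) \<and> u \<in> poly_functions \<and> (\<forall>x\<in>X. g x \<noteq> 0 \<longrightarrow> u x \<noteq> 0) \<and>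
      (\<forall>t \<xi>. t \<noteq> 0 \<longrightarrow> \<xi> \<in> D \<longrightarrow> S t \<xi> \<in> X \<and> evaluation B (S t \<xi>) = \<xi> \<and> u (S t \<xi>) = t) \<and>
      (\<forall>x\<in>X. g x \<noteq> 0 \<longrightarrow> S (u x) (evaluation B x) = x) \<and>
      (\<forall>i. (\<lambda>t \<xi>. S t \<xi> $ i) \<in> laurent_over D (fractions X B g)))"

text \<open>
  Write every coordinate function as a sum of homogeneous parts, each a power of \<open>u\<close> times a fraction
  of invariants; replacing \<open>u\<close> by \<open>t\<close> and the invariants by the values of a character \<open>\<xi>\<close> defines
  \<open>S t \<xi>\<close>. All that has to be known about \<open>S\<close> then consists of identities between Laurent
  polynomials over the localised invariants. By definition they hold at the points
  \<open>(u x, evaluation B x)\<close>, and these determine a Laurent polynomial: the orbit of \<open>x\<close> gives \<open>u\<close> all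
  nonzero values over the same point of the quotient, so the coefficients vanish on the part
  \<open>g \<noteq> 0\<close> of \<open>X\<close>, hence in the localised ring of invariants.
\<close>

theorem quotient_splitting_exists:
  fixes X :: "(complex ^ 'n) set"
  assumes alg: "algebraic_set X" and int: "integral_on X" and act: "algebraic_Gm_action X \<sigma>"
    and pos: "f1 \<in> semi_invariants X \<sigma> n1" "n1 > 0" "x1 \<in> X" "f1 x1 \<noteq> 0"
    and neg: "f2 \<in> semi_invariants X \<sigma> n2" "n2 < 0" "x2 \<in> X" "f2 x2 \<noteq> 0"
  shows "\<exists>g u S. quotient_splitting X \<sigma> g u S"
proof -
  define B where "B = invariant_ring X \<sigma>"
  have into: "\<sigma> t x \<in> X" if "t \<noteq> 0" "x \<in> X" for t x
    using act that by (simp add: algebraic_Gm_action_def)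
  have one: "\<sigma> 1 x = x" if "x \<in> X" for x
    using act that by (simp add: algebraic_Gm_action_def)
  have comp: "\<sigma> (s * t) x = \<sigma> s (\<sigma> t x)" if "s \<noteq> 0" "t \<noteq> 0" "x \<in> X" for s t x
    using act that by (simp add: algebraic_Gm_action_def)
  have B: "restricted_algebra X B"
    unfolding B_def using into by (rule restricted_algebra_invariant_ring)
  have inB: "restrict f X \<in> B" if "f \<in> semi_invariants X \<sigma> 0" for f
    unfolding B_def using into that by (rule restrict_in_invariant_ring)
  have inv: "f (\<sigma> t x) = f x" if "f \<in> B" "t \<noteq> 0" "x \<in> X" for f t x
    using that by (simp add: B_def invariant_ring_def)

  define M where "M = {n. \<exists>f\<in>semi_invariants X \<sigma> n. \<exists>x\<in>X. f x \<noteq> 0}"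
  have M_add: "m + n \<in> M" if "m \<in> M" "n \<in> M" for m n
  proof -
    obtain f h where fh: "f \<in> semi_invariants X \<sigma> m" "\<exists>x\<in>X. f x \<noteq> 0"
      "h \<in> semi_invariants X \<sigma> n" "\<exists>x\<in>X. h x \<noteq> 0"
      using \<open>m \<in> M\<close> \<open>n \<in> M\<close> unfolding M_def mem_Collect_eq by metis
    have "\<exists>x\<in>X. f x * h x \<noteq> 0"
      by (rule integral_on_mult[OF int fh(1,3)[THEN semi_invariants_poly] fh(2,4)])
    then show ?thesis
      using semi_invariants_mult[OF fh(1,3)] unfolding M_def mem_Collect_eq by (rule bexI)
  qed
  have "n1 \<in> M" "n2 \<in> M"
    unfolding M_def mem_Collect_eq
    by (rule bexI[OF _ pos(1)], rule bexI[OF _ pos(3)], rule pos(4),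
        rule bexI[OF _ neg(1)], rule bexI[OF _ neg(3)], rule neg(4))
  then obtain d where d: "d > 0" "d \<in> M" "- d \<in> M" "\<And>n. n \<in> M \<Longrightarrow> d dvd n"
    using additive_int_set_multiples[OF M_add _ pos(2) _ neg(2)] by blast
  obtain u w where u: "u \<in> semi_invariants X \<sigma> d" "\<exists>x\<in>X. u x \<noteq> 0"
    and w: "w \<in> semi_invariants X \<sigma> (- d)" "\<exists>x\<in>X. w x \<noteq> 0"
    using d(2,3) unfolding M_def mem_Collect_eq by metis
  define g where "g = restrict (\<lambda>x. u x * w x) X"
  have gx: "g x = u x * w x" if "x \<in> X" for x
    using that by (simp add: g_def)
  have g: "g \<in> B"
    unfolding g_def using inB[of "\<lambda>x. u x * w x"] semi_invariants_mult[OF u(1) w(1)] by simp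
  have g_nz: "\<exists>x\<in>X. g x \<noteq> 0"
  proof -
    have "\<exists>x\<in>X. u x * w x \<noteq> 0"
      by (rule integral_on_mult[OF int u(1)[THEN semi_invariants_poly] w(1)[THEN semi_invariants_poly] u(2) w(2)])
    then show ?thesis by (simp add: gx)
  qed
  define D where "D = principal_characters X B g"
  define C where "C = fractions X B g"
  interpret coefficient_algebra C D
    unfolding C_def using B g by (rule coefficient_algebra_fractions)
  have ev_D: "evaluation B x \<in> D" if "x \<in> X" "g x \<noteq> 0" for x
    using that evaluation_in_characters[OF B] g by (simp add: D_def principal_characters_def)

  \<comment> \<open>If \<open>n = k d\<close>, the invariant \<open>f w\<^sup>k\<close> (or \<open>f u\<^sup>-\<^sup>k\<close> for negative \<open>k\<close>) takes care of \<open>f\<close>. If \<open>d\<close>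
      does not divide \<open>n\<close>, then \<open>f\<close> vanishes on \<open>X\<close> and the fraction 0 serves.\<close>
  have factor: "\<exists>\<beta>\<in>C. \<forall>x\<in>X. g x \<noteq> 0 \<longrightarrow> f x = u x powi (n div d) * \<beta> (evaluation B x)"
    if f: "f \<in> semi_invariants X \<sigma> n" for f n
  proof (cases "n \<in> M")
    case False
    then have "\<forall>x\<in>X. f x = 0"
      using f by (auto simp: M_def)
    then show ?thesis
      using const_mem[of 0] by (intro bexI[of _ "\<lambda>_. 0"]) auto
  next
    case True
    define k where "k = n div d"
    have n: "n = k * d"
      using d(4)[OF True] by (simp add: k_def)
    have uw: "u x \<noteq> 0" "w x \<noteq> 0" if "x \<in> X" "g x \<noteq> 0" for x
      using that by (auto simp: gx)
    show ?thesis
    proof (cases "k \<ge> 0")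
      case True
      define c where "c = restrict (\<lambda>x. f x * w x ^ nat k) X"
      have c: "c \<in> B"
        unfolding c_def using semi_invariants_mult[OF f semi_invariants_power[OF w(1), of "nat k"]] True
        by (intro inB) (simp add: n)
      show ?thesis
      proof (intro bexI ballI impI)
        show "(\<lambda>\<xi>. \<xi> c / \<xi> g ^ nat k) \<in> C"
          using c unfolding C_def fractions_def by blast
        fix x assume x: "x \<in> X" "g x \<noteq> 0"
        have "u x powi k = u x ^ nat k"
          using True by (simp add: power_int_def)
        then show "f x = u x powi (n div d) * (evaluation B x c / evaluation B x g ^ nat k)"
          using c g x uw[OF x] unfolding k_def[symmetric]
          by (simp add: gx c_def power_mult_distrib)
      qed
    next
      case False
      define c where "c = restrict (\<lambda>x. f x * u x ^ nat (- k)) X"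
      have c: "c \<in> B"
        unfolding c_def using semi_invariants_mult[OF f semi_invariants_power[OF u(1), of "nat (- k)"]] False
        by (intro inB) (simp add: n)
      show ?thesis
      proof (intro bexI ballI impI)
        have "\<forall>\<xi>\<in>principal_characters X B g. \<xi> c = \<xi> c / \<xi> g ^ 0" by simp
        then show "(\<lambda>\<xi>. \<xi> c) \<in> C"
          using c unfolding C_def fractions_def by blast
        fix x assume x: "x \<in> X" "g x \<noteq> 0"
        have "u x powi k = inverse (u x ^ nat (- k))"
          using False by (simp add: power_int_def power_inverse)
        then show "f x = u x powi (n div d) * evaluation B x c"
          using c g x uw[OF x] unfolding k_def[symmetric]
          by (simp add: c_def field_simps)
      qed
    qed
  qed

  \<comment> \<open>A Laurent polynomial over the localised invariants is determined by its values on \<open>X\<close>.\<close>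
  have vanish: "F t \<xi> = 0"
    if F: "F \<in> laurent_over D C" and zero: "\<And>x. x \<in> X \<Longrightarrow> g x \<noteq> 0 \<Longrightarrow> F (u x) (evaluation B x) = 0"
      and t: "t \<noteq> 0" and \<xi>: "\<xi> \<in> D" for F t \<xi>
  proof -
    obtain K \<beta> where K: "finite K" and \<beta>: "\<And>n::int. \<beta> n \<in> C"
      and F_eq: "\<And>t y. t \<noteq> 0 \<Longrightarrow> y \<in> D \<Longrightarrow> F t y = (\<Sum>n\<in>K. t powi n * \<beta> n y)"
      using laurent_overD[OF F] by meson
    have F0: "F z (evaluation B x) = 0" if x: "x \<in> X" "g x \<noteq> 0" and z: "z \<noteq> 0" for x z
    proof -
      have ux: "u x \<noteq> 0" using x gx by auto
      \<comment> \<open>A \<open>d\<close>-th root of \<open>z / u x\<close>: acting with it moves \<open>u\<close> to the value \<open>z\<close>.\<close>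
      define s where "s = exp (Ln (z / u x) / of_int d)"
      have s: "s \<noteq> 0" by (simp add: s_def)
      have "s powi d = s ^ nat d"
        using d(1) by (simp add: power_int_def)
      also have "\<dots> = exp (of_nat (nat d) * (Ln (z / u x) / of_int d))"
        by (simp only: s_def exp_of_nat_mult)
      also have "\<dots> = z / u x"
        using d(1) z ux by simp
      finally have "u (\<sigma> s x) = z"
        using u(1) s x ux by (simp add: semi_invariants_def)
      moreover have "evaluation B (\<sigma> s x) = evaluation B x"
        unfolding evaluation_def using inv s x by (auto simp: restrict_def)
      moreover have "g (\<sigma> s x) \<noteq> 0"
        using inv[OF g s] x by simp
      ultimately show ?thesis
        using zero[OF into[OF s x(1)]] by simp
    qed
    have "\<beta> n \<xi> = 0" if n: "n \<in> K" for n
    proof -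
      obtain c N where c: "c \<in> B" and \<beta>_eq: "\<And>\<xi>. \<xi> \<in> D \<Longrightarrow> \<beta> n \<xi> = \<xi> c / \<xi> g ^ N"
        using \<beta>[of n] unfolding C_def fractions_def mem_Collect_eq D_def by meson
      have "g x * c x = 0" if x: "x \<in> X" for x
      proof (cases "g x = 0")
        case False
        have "\<beta> n (evaluation B x) = 0"
        proof (rule laurent_coeffs_zero[OF K _ n])
          fix z :: complex assume "z \<noteq> 0"
          then show "(\<Sum>n\<in>K. z powi n * \<beta> n (evaluation B x)) = 0"
            using F0[OF x False] F_eq[OF _ ev_D[OF x False]] by simp
        qed
        then show ?thesis
          using \<beta>_eq[OF ev_D[OF x False]] c g False by simp
      qed simp
      then have "(\<lambda>x\<in>X. g x * c x) = (\<lambda>x\<in>X. 0)"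
        by (auto simp: restrict_def)
      moreover have "\<xi> \<in> algebra_characters X B" "\<xi> g \<noteq> 0"
        using \<xi> by (auto simp: D_def principal_characters_def)
      ultimately have "\<xi> c = 0"
        using character_mult[of \<xi> X B g c] character_const[of \<xi> X B 0] g c by simp
      then show ?thesis
        using \<beta>_eq[OF \<xi>] by simp
    qed
    then show ?thesis
      using F_eq[OF t \<xi>] by simp
  qed

  have "\<exists>F\<in>laurent_over D C. \<forall>x\<in>X. g x \<noteq> 0 \<longrightarrow> F (u x) (evaluation B x) = x $ i" for i
  proof -
    obtain K c where K: "finite K" and semi: "\<And>n. n \<in> K \<Longrightarrow> c n \<in> semi_invariants X \<sigma> n"
      and \<sigma>_eq: "\<And>t x. t \<noteq> 0 \<Longrightarrow> x \<in> X \<Longrightarrow> \<sigma> t x $ i = (\<Sum>n\<in>K. t powi n * c n x)"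
      using action_coordinate_decomposition[OF act, of i] by meson
    have "\<forall>n. \<exists>\<beta>. n \<in> K \<longrightarrow> \<beta> \<in> C \<and>
        (\<forall>x\<in>X. g x \<noteq> 0 \<longrightarrow> c n x = u x powi (n div d) * \<beta> (evaluation B x))"
    proof
      fix n
      show "\<exists>\<beta>. n \<in> K \<longrightarrow> \<beta> \<in> C \<and>
        (\<forall>x\<in>X. g x \<noteq> 0 \<longrightarrow> c n x = u x powi (n div d) * \<beta> (evaluation B x))"
      proof (cases "n \<in> K")
        case True
        from factor[OF semi[OF True]] show ?thesis
          by (elim bexE) (rule exI, rule impI, rule conjI)
      qed simp
    qed
    from choice[OF this] obtain \<beta> where *: "\<forall>n. n \<in> K \<longrightarrow> \<beta> n \<in> C \<and>
        (\<forall>x\<in>X. g x \<noteq> 0 \<longrightarrow> c n x = u x powi (n div d) * \<beta> n (evaluation B x))" ..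
    have \<beta>: "\<And>n. n \<in> K \<Longrightarrow> \<beta> n \<in> C"
      and c_eq: "\<And>n x. n \<in> K \<Longrightarrow> x \<in> X \<Longrightarrow> g x \<noteq> 0 \<Longrightarrow>
        c n x = u x powi (n div d) * \<beta> n (evaluation B x)"
      using * by simp_all
    show ?thesis
    proof (intro bexI ballI impI)
      show "(\<lambda>t \<xi>. \<Sum>n\<in>K. t powi (n div d) * \<beta> n \<xi>) \<in> laurent_over D C"
        by (intro laurent_sum laurent_monomial \<beta>)
      fix x assume x: "x \<in> X" "g x \<noteq> 0"
      have "x $ i = (\<Sum>n\<in>K. c n x)"
        using \<sigma>_eq[of 1 x] one[OF x(1)] x(1) by simp
      also have "\<dots> = (\<Sum>n\<in>K. u x powi (n div d) * \<beta> n (evaluation B x))"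
        using c_eq x by (intro sum.cong) auto
      finally show "(\<Sum>n\<in>K. u x powi (n div d) * \<beta> n (evaluation B x)) = x $ i" by simp
    qed
  qed
  then have "\<forall>i. \<exists>F. F \<in> laurent_over D C \<and> (\<forall>x\<in>X. g x \<noteq> 0 \<longrightarrow> F (u x) (evaluation B x) = x $ i)"
    unfolding Bex_def by (rule allI)
  from choice[OF this] obtain F where *: "\<forall>i. F i \<in> laurent_over D C \<and>
      (\<forall>x\<in>X. g x \<noteq> 0 \<longrightarrow> F i (u x) (evaluation B x) = x $ i)" ..
  have F: "\<And>i. F i \<in> laurent_over D C"
    and F_eq: "\<And>i x. x \<in> X \<Longrightarrow> g x \<noteq> 0 \<Longrightarrow> F i (u x) (evaluation B x) = x $ i"
    using * by simp_all
  define S where "S t \<xi> = (\<chi> i. F i t \<xi>)" for t \<xi>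
  have S: "(\<lambda>t \<xi>. S t \<xi> $ i) \<in> laurent_over D C" for i
    using F by (simp add: S_def)
  have S_eq: "S (u x) (evaluation B x) = x" if "x \<in> X" "g x \<noteq> 0" for x
    using F_eq[OF that] by (simp add: S_def vec_eq_iff)
  have up: "u \<in> poly_functions"
    using u by (simp add: semi_invariants_def)
  \<comment> \<open>Identities that hold on \<open>X\<close> carry over to \<open>S\<close>. The defining equations of \<open>X\<close>, the invariants and
      \<open>u\<close> itself give the three properties of \<open>S t \<xi>\<close>.\<close>
  have transport: "P (S t \<xi>) = \<beta> t \<xi>"
    if P: "P \<in> poly_functions" and \<beta>: "\<beta> \<in> laurent_over D C"
      and eq: "\<And>x. x \<in> X \<Longrightarrow> g x \<noteq> 0 \<Longrightarrow> P x = \<beta> (u x) (evaluation B x)"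
      and *: "t \<noteq> 0" "\<xi> \<in> D" for P \<beta> t \<xi>
  proof -
    have "(\<lambda>t \<xi>. P (S t \<xi>) + (- 1) * \<beta> t \<xi>) \<in> laurent_over D C"
      by (intro laurent_add laurent_mult laurent_poly_comp[OF P S] \<beta> laurent_coeff const_mem)
    from vanish[OF this _ *] show ?thesis
      using eq S_eq by simp
  qed
  have SX: "S t \<xi> \<in> X" if *: "t \<noteq> 0" "\<xi> \<in> D" for t \<xi>
  proof -
    obtain Z where Z: "Z \<subseteq> poly_functions" "X = {x. \<forall>f\<in>Z. f x = 0}"
      using alg unfolding algebraic_set_def by blast
    have "f (S t \<xi>) = 0" if "f \<in> Z" for f
      by (rule transport[OF _ laurent_coeff[OF const_mem[of 0]] _ *]) (use Z that in auto)
    then show ?thesis using Z by simp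
  qed
  moreover have "u (S t \<xi>) = t" if *: "t \<noteq> 0" "\<xi> \<in> D" for t \<xi>
    using transport[OF up laurent_monomial[OF const_mem[of 1], of 1] _ *] by simp
  moreover have "evaluation B (S t \<xi>) = \<xi>" if *: "t \<noteq> 0" "\<xi> \<in> D" for t \<xi>
  proof (rule extensionalityI[of _ B])
    show "evaluation B (S t \<xi>) \<in> extensional B"
      by (simp add: evaluation_def)
    show "\<xi> \<in> extensional B"
      using *(2) character_extensional by (auto simp: D_def principal_characters_def)
    fix f assume f: "f \<in> B"
    obtain p where p: "p \<in> poly_functions" "\<And>x. x \<in> X \<Longrightarrow> f x = p x"
      using invariant_ringE f unfolding B_def by meson
    have "\<forall>\<xi>\<in>principal_characters X B g. \<xi> f = \<xi> f / \<xi> g ^ 0" by simp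
    then have "(\<lambda>\<xi>. \<xi> f) \<in> C"
      using f unfolding C_def fractions_def by blast
    from transport[OF p(1) laurent_coeff[OF this] _ *] have "p (S t \<xi>) = \<xi> f"
      using p(2) f by simp
    then show "evaluation B (S t \<xi>) f = \<xi> f"
      using f p(2)[OF SX[OF *]] by simp
  qed
  moreover have "\<forall>x\<in>X. g x \<noteq> 0 \<longrightarrow> u x \<noteq> 0"
    using gx by auto
  ultimately have "quotient_splitting X \<sigma> g u S"
    unfolding quotient_splitting_def Let_def B_def[symmetric] D_def[symmetric] C_def[symmetric]
    using g g_nz up S S_eq by simp
  then show ?thesis by blast
qed

section \<open>Birational maps from isomorphisms of quotients\<close>

text \<open>
  The generating sets are already closed under intersection, because \<open>R\<close> is closed under products.
\<close>

lemma zariski_space_base: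
  assumes R: "function_algebra P R" and "openin (zar (zariski_space P R)) W" "x \<in> W"
  shows "\<exists>f\<in>R. f x \<noteq> 0 \<and> {y \<in> P. f y \<noteq> 0} \<subseteq> W"
proof -
  have "generate_topology_on {{x \<in> P. f x \<noteq> 0} |f. f \<in> R} W"
    using assms(2) unfolding zar_zariski_space openin_topology_generated_by_iff .
  then have "\<forall>x\<in>W. x \<in> P \<and> (\<exists>f\<in>R. f x \<noteq> 0 \<and> {y \<in> P. f y \<noteq> 0} \<subseteq> W)"
  proof induction
    case (Int A B)
    show ?case
    proof
      fix x assume x: "x \<in> A \<inter> B"
      obtain f where f: "f \<in> R" "f x \<noteq> 0" "{y \<in> P. f y \<noteq> 0} \<subseteq> A" and xP: "x \<in> P"
        using Int.IH(1) x by (meson IntD1)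
      obtain h where h: "h \<in> R" "h x \<noteq> 0" "{y \<in> P. h y \<noteq> 0} \<subseteq> B"
        using Int.IH(2) x by (meson IntD2)
      have "\<exists>k\<in>R. \<forall>y\<in>P. k y = f y * h y"
        using R f(1) h(1) unfolding function_algebra_def by simp
      then obtain k where k: "k \<in> R" "\<forall>y\<in>P. k y = f y * h y" ..
      have "k x \<noteq> 0 \<and> {y \<in> P. k y \<noteq> 0} \<subseteq> A \<inter> B"
        using k(2) f h xP by auto
      then show "x \<in> P \<and> (\<exists>f\<in>R. f x \<noteq> 0 \<and> {y \<in> P. f y \<noteq> 0} \<subseteq> A \<inter> B)"
        using k(1) xP by meson
    qed
  next
    case (UN \<K>)
    show ?case
    proof
      fix x assume "x \<in> \<Union>\<K>"
      then obtain A where A: "A \<in> \<K>" "x \<in> A" by blast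
      then obtain f where "f \<in> R" "f x \<noteq> 0" "{y \<in> P. f y \<noteq> 0} \<subseteq> A" "x \<in> P"
        using UN.IH[OF A(1)] by meson
      moreover have "A \<subseteq> \<Union>\<K>" using A by blast
      ultimately show "x \<in> P \<and> (\<exists>f\<in>R. f x \<noteq> 0 \<and> {y \<in> P. f y \<noteq> 0} \<subseteq> \<Union>\<K>)"
        by (meson subset_trans)
    qed
  next
    case (Basis A)
    then obtain f where f: "f \<in> R" "A = {x \<in> P. f x \<noteq> 0}" by auto
    show ?case
      unfolding f(2) by (intro ballI conjI bexI[OF _ f(1)]) auto
  qed simp
  then show ?thesis
    using assms(3) by simp
qed

lemma function_algebra_coordinate_ring: "function_algebra X (coordinate_ring X)"
  unfolding function_algebra_def
proof (intro conjI allI ballI)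
  fix c
  have "restrict (\<lambda>_. c) X \<in> coordinate_ring X"
    unfolding coordinate_ring_def by (intro imageI poly_functions_const)
  then show "\<exists>k\<in>coordinate_ring X. \<forall>x\<in>X. k x = c"
    by (rule bexI[rotated]) simp
next
  fix f g assume "f \<in> coordinate_ring X" "g \<in> coordinate_ring X"
  then obtain p q where p: "p \<in> poly_functions" "f = restrict p X"
    and q: "q \<in> poly_functions" "g = restrict q X"
    unfolding coordinate_ring_def by auto
  have "restrict (\<lambda>x. p x + q x) X \<in> coordinate_ring X" "restrict (\<lambda>x. p x * q x) X \<in> coordinate_ring X"
    unfolding coordinate_ring_def using p q
    by (intro imageI poly_functions_add poly_functions_mult; simp)+
  from this(1) show "\<exists>k\<in>coordinate_ring X. \<forall>x\<in>X. k x = f x + g x"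
    by (rule bexI[rotated]) (simp add: p q)
  from \<open>restrict (\<lambda>x. p x * q x) X \<in> coordinate_ring X\<close>
  show "\<exists>k\<in>coordinate_ring X. \<forall>x\<in>X. k x = f x * g x"
    by (rule bexI[rotated]) (simp add: p q)
qed

lemma topspace_affine_space_of [simp]: "topspace (zar (affine_space_of X)) = X"
  unfolding affine_space_of_def by (rule topspace_zariski_space[OF function_algebra_coordinate_ring])

lemma function_space_affine_space_of: "function_space (affine_space_of X)"
  unfolding affine_space_of_def by (rule function_space_zariski_space[OF function_algebra_coordinate_ring])

lemma poly_functions_regular:
  assumes "f \<in> poly_functions"
  shows "f \<in> reg (affine_space_of X) X"
proof -
  interpret function_space "affine_space_of X" by (rule function_space_affine_space_of)
  have X: "openin (zar (affine_space_of X)) X"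
    using openin_topspace[of "zar (affine_space_of X)"] by simp
  have "restrict f X \<in> reg (affine_space_of X) X"
    using X assms unfolding affine_space_of_def
    by (intro algebra_reg_zariski_space[OF function_algebra_coordinate_ring]) (auto simp: coordinate_ring_def)
  then show ?thesis
    by (rule reg_cong[OF X]) simp
qed

lemma (in function_space) poly_functions_pullback:
  assumes U: "openin (zar S) U" and "f \<in> poly_functions" "\<And>i. (\<lambda>x. \<phi> x $ i) \<in> reg S U"
  shows "(\<lambda>x. f (\<phi> x)) \<in> reg S U"
  using assms(2)
  by (induction rule: poly_functions_induct) (auto intro: assms(3) reg_const reg_add reg_mult U)

lemma (in function_space) morphism_into_affine_space:
  assumes "\<And>x. x \<in> topspace (zar S) \<Longrightarrow> \<phi> x \<in> X"
    and "\<And>i. (\<lambda>x. \<phi> x $ i) \<in> reg S (topspace (zar S))"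
  shows "morphism S (affine_space_of X) \<phi>"
  unfolding affine_space_of_def
proof (rule morphism_into_zariski_space[OF function_algebra_coordinate_ring assms(1)])
  fix f assume "f \<in> coordinate_ring X"
  then obtain p where p: "p \<in> poly_functions" "f = restrict p X"
    unfolding coordinate_ring_def by auto
  show "(\<lambda>x. f (\<phi> x)) \<in> reg S (topspace (zar S))"
    by (rule reg_cong[OF openin_topspace poly_functions_pullback[OF openin_topspace p(1) assms(2)]])
      (simp add: p(2) assms(1))
qed

lemma topspace_affine_quotient:
  assumes "restricted_algebra X (invariant_ring X \<sigma>)"
  shows "topspace (zar (affine_quotient X \<sigma>)) = algebra_characters X (invariant_ring X \<sigma>)"
  unfolding affine_quotient_def spectrum_def
  by (rule topspace_zariski_space[OF function_algebra_characters[OF assms]])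

lemma invariants_regular_on_quotient:
  assumes B: "restricted_algebra X (invariant_ring X \<sigma>)" and f: "f \<in> invariant_ring X \<sigma>"
  shows "(\<lambda>\<xi>. \<xi> f) \<in> reg (affine_quotient X \<sigma>) (topspace (zar (affine_quotient X \<sigma>)))"
  unfolding affine_quotient_def spectrum_def
  by (intro algebra_reg_zariski_space[OF function_algebra_characters[OF B]] imageI f openin_topspace)

lemma invariants_regular_pullback:
  assumes B: "restricted_algebra X (invariant_ring X \<sigma>)" and f: "f \<in> invariant_ring X \<sigma>"
    and a: "morphism Z (affine_quotient X \<sigma>) a"
  shows "(\<lambda>z. a z f) \<in> reg Z (topspace (zar Z))"
proof -
  let ?Q = "affine_quotient X \<sigma>"
  have "(\<lambda>\<xi>. \<xi> f) \<circ> a \<in> reg Z {z \<in> topspace (zar Z). a z \<in> topspace (zar ?Q)}"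
    by (rule a[unfolded morphism_def, THEN conjunct2, rule_format, OF openin_topspace
          invariants_regular_on_quotient[OF B f]])
  moreover have "{z \<in> topspace (zar Z). a z \<in> topspace (zar ?Q)} = topspace (zar Z)"
    using a by (auto simp: morphism_def continuous_map_def)
  ultimately show ?thesis
    by (simp add: comp_def)
qed

lemma morphism_evaluation:
  assumes B: "restricted_algebra X (invariant_ring X \<sigma>)"
  shows "morphism (affine_space_of X) (affine_quotient X \<sigma>) (evaluation (invariant_ring X \<sigma>))"
proof -
  interpret function_space "affine_space_of X" by (rule function_space_affine_space_of)
  show ?thesis
    unfolding affine_quotient_def spectrum_def
  proof (rule morphism_into_zariski_space[OF function_algebra_characters[OF B]])
    fix x assume "x \<in> topspace (zar (affine_space_of X))"
    then show "evaluation (invariant_ring X \<sigma>) x \<in> algebra_characters X (invariant_ring X \<sigma>)"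
      using evaluation_in_characters[OF B] by simp
  next
    fix f' :: "((complex ^ 'a \<Rightarrow> complex) \<Rightarrow> complex) \<Rightarrow> complex"
    assume "f' \<in> (\<lambda>f \<xi>. \<xi> f) ` invariant_ring X \<sigma>"
    then obtain f where f: "f \<in> invariant_ring X \<sigma>" "f' = (\<lambda>\<xi>. \<xi> f)" by auto
    have "f \<in> reg (affine_space_of X) (topspace (zar (affine_space_of X)))"
      unfolding affine_space_of_def
      by (rule algebra_reg_zariski_space[OF function_algebra_coordinate_ring _ openin_topspace])
        (use f(1) in \<open>simp add: invariant_ring_def\<close>)
    then show "(\<lambda>x. f' (evaluation (invariant_ring X \<sigma>) x))
        \<in> reg (affine_space_of X) (topspace (zar (affine_space_of X)))"
      by (rule reg_cong[OF openin_topspace]) (simp add: f)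
  qed
qed

lemma
  assumes "quotient_splitting X \<sigma> g u S"
  shows splitting_g: "g \<in> invariant_ring X \<sigma>"
    and splitting_g_nonzero: "\<exists>x\<in>X. g x \<noteq> 0"
    and splitting_u: "u \<in> poly_functions"
    and splitting_u_nonzero: "\<And>x. x \<in> X \<Longrightarrow> g x \<noteq> 0 \<Longrightarrow> u x \<noteq> 0"
    and splitting_section: "\<And>t \<xi>. t \<noteq> 0 \<Longrightarrow> \<xi> \<in> algebra_characters X (invariant_ring X \<sigma>) \<Longrightarrow> \<xi> g \<noteq> 0 \<Longrightarrow>
      S t \<xi> \<in> X \<and> evaluation (invariant_ring X \<sigma>) (S t \<xi>) = \<xi> \<and> u (S t \<xi>) = t"
    and splitting_section_eq: "\<And>x. x \<in> X \<Longrightarrow> g x \<noteq> 0 \<Longrightarrow> S (u x) (evaluation (invariant_ring X \<sigma>) x) = x"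
    and splitting_laurent: "\<And>i. (\<lambda>t \<xi>. S t \<xi> $ i) \<in>
      laurent_over (principal_characters X (invariant_ring X \<sigma>) g) (fractions X (invariant_ring X \<sigma>) g)"
  using assms by (auto simp: quotient_splitting_def Let_def principal_characters_def)

text \<open>
  A family of points of the quotient over \<open>g \<noteq> 0\<close>, together with a family of nonzero scalars, is
  turned by the section into a family of points of the variety.
\<close>

lemma (in function_space) morphism_splitting_section:
  fixes V :: "(complex ^ 'm) set"
  assumes split: "quotient_splitting V \<rho> g u T"
    and B: "restricted_algebra V (invariant_ring V \<rho>)"
    and a: "morphism S (affine_quotient V \<rho>) a"
    and a_nz: "\<And>x. x \<in> topspace (zar S) \<Longrightarrow> a x g \<noteq> 0"
    and s: "s \<in> reg S (topspace (zar S))" and s_nz: "\<And>x. x \<in> topspace (zar S) \<Longrightarrow> s x \<noteq> 0"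
  shows "morphism S (affine_space_of V) (\<lambda>x. T (s x) (a x))"
proof (rule morphism_into_affine_space)
  let ?B = "invariant_ring V \<rho>"
  let ?D = "principal_characters V ?B g"
  have aD: "a x \<in> algebra_characters V ?B" if "x \<in> topspace (zar S)" for x
    using a that topspace_affine_quotient[OF B] by (auto simp: morphism_def continuous_map_def)
  then show "T (s x) (a x) \<in> V" if "x \<in> topspace (zar S)" for x
    using splitting_section[OF split, of "s x" "a x"] s_nz a_nz that by simp
  have frac: "(\<lambda>x. \<beta> (a x)) \<in> reg S (topspace (zar S))" if \<beta>: "\<beta> \<in> fractions V ?B g" for \<beta>
  proof -
    obtain c N where c: "c \<in> ?B" and \<beta>_eq: "\<And>\<xi>. \<xi> \<in> ?D \<Longrightarrow> \<beta> \<xi> = \<xi> c / \<xi> g ^ N"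
      using \<beta> unfolding fractions_def mem_Collect_eq by meson
    have "(\<lambda>x. a x c / a x g ^ N) \<in> reg S (topspace (zar S))"
      by (intro reg_divide reg_power openin_topspace invariants_regular_pullback[OF B _ a] c
          splitting_g[OF split]) (simp add: a_nz)
    then show ?thesis
      by (rule reg_cong[OF openin_topspace])
        (rule \<beta>_eq, simp add: principal_characters_def aD a_nz)
  qed
  fix i
  obtain K \<beta> where K: "finite K" "\<And>n::int. \<beta> n \<in> fractions V ?B g"
    and eq: "\<And>t \<xi>. t \<noteq> 0 \<Longrightarrow> \<xi> \<in> ?D \<Longrightarrow> T t \<xi> $ i = (\<Sum>n\<in>K. t powi n * \<beta> n \<xi>)"
    using laurent_overD[OF splitting_laurent[OF split, of i]] by meson
  have "(\<lambda>x. \<Sum>n\<in>K. s x powi n * \<beta> n (a x)) \<in> reg S (topspace (zar S))"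
    by (intro reg_sum reg_mult reg_powi openin_topspace frac s s_nz K)
  then show "(\<lambda>x. T (s x) (a x) $ i) \<in> reg S (topspace (zar S))"
    by (rule reg_cong[OF openin_topspace])
      (rule eq, simp add: s_nz, simp add: principal_characters_def aD a_nz)
qed

text \<open>
  One direction of the birational map: a point \<open>x\<close> is sent to the point with the same scalar \<open>u x\<close>
  over the image under \<open>\<phi>\<close> of its class in the quotient. Exchanging the roles of \<open>X\<close> and \<open>V\<close> gives
  the inverse.
\<close>

lemma splitting_transfer:
  fixes X :: "(complex ^ 'n) set" and V :: "(complex ^ 'm) set"
  assumes splitX: "quotient_splitting X \<sigma> g u S" and splitV: "quotient_splitting V \<rho> g' u' S'"
    and BX: "restricted_algebra X (invariant_ring X \<sigma>)"
    and BV: "restricted_algebra V (invariant_ring V \<rho>)"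
    and \<phi>: "morphism (affine_quotient X \<sigma>) (affine_quotient V \<rho>) \<phi>"
  defines "a \<equiv> \<lambda>x. \<phi> (evaluation (invariant_ring X \<sigma>) x)"
  defines "U \<equiv> {x \<in> X. g x \<noteq> 0 \<and> a x g' \<noteq> 0}"
  shows "openin (zar (affine_space_of X)) U"
    and "morphism (open_subspace (affine_space_of X) U) (affine_space_of V) (\<lambda>x. S' (u x) (a x))"
    and "\<And>x. x \<in> U \<Longrightarrow> S' (u x) (a x) \<in> V \<and>
      evaluation (invariant_ring V \<rho>) (S' (u x) (a x)) = a x \<and> u' (S' (u x) (a x)) = u x"
proof -
  let ?A = "affine_space_of X"
  interpret function_space ?A by (rule function_space_affine_space_of)
  have X: "openin (zar ?A) X"
    using openin_topspace[of "zar ?A"] by simp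
  have a: "morphism ?A (affine_quotient V \<rho>) a"
    using morphism_comp[OF morphism_evaluation[OF BX] \<phi>] by (simp add: a_def comp_def)
  have ag: "(\<lambda>x. a x g') \<in> reg ?A X"
    using invariants_regular_pullback[OF BV splitting_g[OF splitV] a] by simp
  have "g \<in> reg ?A X"
    unfolding affine_space_of_def
    by (rule algebra_reg_zariski_space[OF function_algebra_coordinate_ring])
      (use splitting_g[OF splitX] X in \<open>simp_all add: invariant_ring_def affine_space_of_def\<close>)
  then have "openin (zar ?A) ({x \<in> X. g x \<noteq> 0} \<inter> {x \<in> X. a x g' \<noteq> 0})"
    using openin_nonzero[OF X] ag by blast
  moreover have "U = {x \<in> X. g x \<noteq> 0} \<inter> {x \<in> X. a x g' \<noteq> 0}"
    by (auto simp: U_def)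
  ultimately show U: "openin (zar ?A) U" by simp
  have UX: "U \<subseteq> X" by (auto simp: U_def)
  interpret U: function_space "open_subspace ?A U"
    using U by (rule function_space_open_subspace)
  have top: "topspace (zar (open_subspace ?A U)) = U"
    using UX by auto
  show "morphism (open_subspace ?A U) (affine_space_of V) (\<lambda>x. S' (u x) (a x))"
  proof (rule U.morphism_splitting_section[OF splitV BV])
    show "morphism (open_subspace ?A U) (affine_quotient V \<rho>) a"
      using U a by (rule morphism_open_subspace)
    show "u \<in> reg (open_subspace ?A U) (topspace (zar (open_subspace ?A U)))"
      using reg_subset[OF X U UX poly_functions_regular[OF splitting_u[OF splitX]]] UX
      unfolding top by simp
  qed (use splitting_u_nonzero[OF splitX] in \<open>simp_all add: top U_def\<close>)
  fix x assume x: "x \<in> U"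
  have "a x \<in> algebra_characters V (invariant_ring V \<rho>)"
    using a x UX topspace_affine_quotient[OF BV] by (auto simp: morphism_def continuous_map_def)
  then show "S' (u x) (a x) \<in> V \<and>
      evaluation (invariant_ring V \<rho>) (S' (u x) (a x)) = a x \<and> u' (S' (u x) (a x)) = u x"
    using splitting_section[OF splitV] splitting_u_nonzero[OF splitX] x by (simp add: U_def)
qed

text \<open>
  Where both splittings are defined, \<open>X\<close> and \<open>V\<close> are products of the multiplicative group with the
  same open subset of the quotient. That such points exist is where the integrality of \<open>X\<close> enters.
\<close>

theorem birational_if_quotients_isomorphic:
  fixes X :: "(complex ^ 'n) set" and V :: "(complex ^ 'm) set"
  assumes splitX: "quotient_splitting X \<sigma> g u S" and splitV: "quotient_splitting V \<rho> g' u' S'"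
    and BX: "restricted_algebra X (invariant_ring X \<sigma>)"
    and BV: "restricted_algebra V (invariant_ring V \<rho>)"
    and int: "integral_on X"
    and iso: "isomorphic (affine_quotient X \<sigma>) (affine_quotient V \<rho>)"
  shows "birational (affine_space_of X) (affine_space_of V)"
proof -
  let ?QX = "affine_quotient X \<sigma>" and ?QV = "affine_quotient V \<rho>"
  let ?B = "invariant_ring X \<sigma>" and ?B' = "invariant_ring V \<rho>"
  obtain \<phi> \<psi> where \<phi>: "morphism ?QX ?QV \<phi>" and \<psi>: "morphism ?QV ?QX \<psi>"
    and \<psi>\<phi>: "\<And>x. x \<in> topspace (zar ?QX) \<Longrightarrow> \<psi> (\<phi> x) = x"
    and \<phi>\<psi>: "\<And>y. y \<in> topspace (zar ?QV) \<Longrightarrow> \<phi> (\<psi> y) = y"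
    using iso unfolding isomorphic_def by meson
  define a where "a x = \<phi> (evaluation ?B x)" for x
  define b where "b y = \<psi> (evaluation ?B' y)" for y
  define U where "U = {x \<in> X. g x \<noteq> 0 \<and> a x g' \<noteq> 0}"
  define W where "W = {y \<in> V. g' y \<noteq> 0 \<and> b y g \<noteq> 0}"
  define F where "F x = S' (u x) (a x)" for x
  define G where "G y = S (u' y) (b y)" for y
  note trX = splitting_transfer[OF splitX splitV BX BV \<phi>, folded a_def, folded U_def, folded F_def]
  note trV = splitting_transfer[OF splitV splitX BV BX \<psi>, folded b_def, folded W_def, folded G_def]
  have g: "g \<in> ?B" and g': "g' \<in> ?B'"
    using splitX splitV by (auto intro: splitting_g)
  have evX: "evaluation ?B x \<in> topspace (zar ?QX)" if "x \<in> X" for x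
    using evaluation_in_characters[OF BX that] topspace_affine_quotient[OF BX] by simp
  have evV: "evaluation ?B' x \<in> topspace (zar ?QV)" if "x \<in> V" for x
    using evaluation_in_characters[OF BV that] topspace_affine_quotient[OF BV] by simp
  have FW: "F x \<in> W" and GF: "G (F x) = x" if x: "x \<in> U" for x
  proof -
    have xX: "x \<in> X" using x by (simp add: U_def)
    have b: "b (F x) = evaluation ?B x"
      using trX(3)[OF x] \<psi>\<phi>[OF evX[OF xX]] by (simp add: b_def a_def)
    have "g' (F x) = evaluation ?B' (F x) g'"
      using g' by simp
    also have "\<dots> = a x g'"
      using trX(3)[OF x] by simp
    finally have "g' (F x) = a x g'" .
    then show "F x \<in> W"
      using x trX(3)[OF x] g b by (simp add: W_def U_def)
    show "G (F x) = x"
      using trX(3)[OF x] b splitting_section_eq[OF splitX xX] x by (simp add: G_def U_def)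
  qed
  have GU: "G y \<in> U" and FG: "F (G y) = y" if y: "y \<in> W" for y
  proof -
    have yV: "y \<in> V" using y by (simp add: W_def)
    have a: "a (G y) = evaluation ?B' y"
      using trV(3)[OF y] \<phi>\<psi>[OF evV[OF yV]] by (simp add: b_def a_def)
    have "g (G y) = evaluation ?B (G y) g"
      using g by simp
    also have "\<dots> = b y g"
      using trV(3)[OF y] by simp
    finally have "g (G y) = b y g" .
    then show "G y \<in> U"
      using y trV(3)[OF y] g' a by (simp add: W_def U_def)
    show "F (G y) = y"
      using trV(3)[OF y] a splitting_section_eq[OF splitV yV] y by (simp add: F_def W_def)
  qed
  have UX: "U \<subseteq> X" and WV: "W \<subseteq> V"
    by (auto simp: U_def W_def)

  \<comment> \<open>The locus \<open>\<phi> \<xi> g' \<noteq> 0\<close> is nonempty and open in the quotient, so it contains a locus \<open>f \<noteq> 0\<close> with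
      an invariant \<open>f \<noteq> 0\<close>, and \<open>f g\<close> does not vanish identically on \<open>X\<close>.\<close>
  have "U \<noteq> {}"
  proof -
    obtain y where y: "y \<in> V" "g' y \<noteq> 0"
      using splitting_g_nonzero[OF splitV] by blast
    define \<xi> where "\<xi> = \<psi> (evaluation ?B' y)"
    have \<xi>: "\<xi> \<in> topspace (zar ?QX)"
      using \<psi> evV[OF y(1)] by (auto simp: \<xi>_def morphism_def continuous_map_def)
    have \<phi>\<xi>: "\<phi> \<xi> g' \<noteq> 0"
      using \<phi>\<psi>[OF evV[OF y(1)]] y(2) g' by (simp add: \<xi>_def)
    let ?W = "{\<xi> \<in> topspace (zar ?QX). \<phi> \<xi> g' \<noteq> 0}"
    interpret Q: function_space ?QX
      unfolding affine_quotient_def spectrum_def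
      by (rule function_space_zariski_space[OF function_algebra_characters[OF BX]])
    have "openin (zar ?QX) ?W"
      by (rule Q.openin_nonzero[OF openin_topspace invariants_regular_pullback[OF BV g' \<phi>]])
    moreover have "\<xi> \<in> ?W" using \<xi> \<phi>\<xi> by simp
    ultimately obtain f' where f': "f' \<in> (\<lambda>f \<xi>. \<xi> f) ` ?B" "f' \<xi> \<noteq> 0"
      "{\<xi> \<in> algebra_characters X ?B. f' \<xi> \<noteq> 0} \<subseteq> ?W"
      using zariski_space_base[OF function_algebra_characters[OF BX], of ?W \<xi>]
      unfolding affine_quotient_def spectrum_def by meson
    then obtain f where f: "f \<in> ?B" "f' = (\<lambda>\<xi>. \<xi> f)" by auto
    have "\<exists>x\<in>X. f x \<noteq> 0"
    proof (rule ccontr)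
      assume "\<not> ?thesis"
      moreover have "f \<in> extensional X"
        using f(1) by (auto simp: invariant_ring_def coordinate_ring_def)
      ultimately have "f = (\<lambda>x\<in>X. 0)"
        by (auto simp: restrict_def extensional_def)
      then have "\<xi> f = 0"
        using \<xi> topspace_affine_quotient[OF BX] character_const[of \<xi> X ?B 0] by simp
      with f'(2) f(2) show False by simp
    qed
    moreover obtain p where p: "p \<in> poly_functions" "\<forall>x\<in>X. f x = p x"
      using invariant_ringE[OF f(1)] by meson
    moreover obtain q where q: "q \<in> poly_functions" "\<forall>x\<in>X. g x = q x"
      using invariant_ringE[OF g] by meson
    ultimately obtain x where x: "x \<in> X" "p x * q x \<noteq> 0"
      using integral_on_mult[OF int p(1) q(1)] splitting_g_nonzero[OF splitX] by auto
    have "evaluation ?B x \<in> ?W"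
      using f'(3) evaluation_in_characters[OF BX x(1)] f x p by auto
    then have "x \<in> U"
      using x q by (simp add: U_def a_def)
    then show ?thesis by blast
  qed
  then have "W \<noteq> {}" using FW by blast
  have "isomorphic (open_subspace (affine_space_of X) U) (open_subspace (affine_space_of V) W)"
    unfolding isomorphic_def
  proof (intro exI conjI ballI)
    show "morphism (open_subspace (affine_space_of X) U) (open_subspace (affine_space_of V) W) F"
      by (rule morphism_into_open_subspace[OF trX(2) trV(1)]) (use FW in simp)
    show "morphism (open_subspace (affine_space_of V) W) (open_subspace (affine_space_of X) U) G"
      by (rule morphism_into_open_subspace[OF trV(2) trX(1)]) (use GU in simp)
  qed (use GF FG in simp_all)
  then show ?thesis
    unfolding birational_def using trX(1) trV(1) \<open>U \<noteq> {}\<close> \<open>W \<noteq> {}\<close> by blast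
qed

section \<open>The tangent space at a fixed point as a variety with a linear action\<close>

lemma integral_on_if_affine_variety:
  assumes "affine_variety X"
  shows "integral_on X"
  unfolding integral_on_def
proof (intro ballI impI)
  fix f g :: "complex ^ 'a \<Rightarrow> complex"
  assume f: "f \<in> poly_functions" and g: "g \<in> poly_functions" and fg: "\<forall>x\<in>X. f x * g x = 0"
  let ?T = "zar (affine_space_of X)"
  have closed: "closedin ?T {x \<in> X. h x = 0}" if h: "h \<in> poly_functions" for h
  proof -
    interpret function_space "affine_space_of X" by (rule function_space_affine_space_of)
    have "openin ?T {x \<in> X. h x \<noteq> 0}"
      using openin_nonzero[of X h] openin_topspace[of ?T] poly_functions_regular[OF h] by simp
    moreover have "X - {x \<in> X. h x = 0} = {x \<in> X. h x \<noteq> 0}" by auto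
    ultimately show ?thesis by (simp add: closedin_def)
  qed
  have "irreducible_space ?T"
    using assms by (simp add: affine_variety_def)
  moreover have "{x \<in> X. f x = 0} \<union> {x \<in> X. g x = 0} = topspace ?T"
    using fg by auto
  ultimately have "{x \<in> X. f x = 0} = X \<or> {x \<in> X. g x = 0} = X"
    using closed[OF f] closed[OF g] unfolding irreducible_space_def by simp
  then show "(\<forall>x\<in>X. f x = 0) \<or> (\<forall>x\<in>X. g x = 0)" by auto
qed

text \<open>
  Two functions that are nonzero at \<open>x\<close> and at \<open>y\<close> respectively are nonzero polynomials on the line
  through \<open>x\<close> and \<open>y\<close>.
\<close>

lemma integral_on_subspace:
  fixes V :: "(complex ^ 'n) set"
  assumes V: "vec.subspace V"
  shows "integral_on V"
  unfolding integral_on_def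
proof (intro ballI impI, rule ccontr)
  fix f g :: "complex ^ 'n \<Rightarrow> complex"
  assume f: "f \<in> poly_functions" and g: "g \<in> poly_functions" and fg: "\<forall>x\<in>V. f x * g x = 0"
  assume "\<not> ((\<forall>x\<in>V. f x = 0) \<or> (\<forall>x\<in>V. g x = 0))"
  then obtain x y where x: "x \<in> V" "f x \<noteq> 0" and y: "y \<in> V" "g y \<noteq> 0" by auto
  obtain p where p: "\<forall>z. f (x + z *s (y - x)) = poly p z"
    using poly_functions_on_line[OF f] by meson
  obtain q where q: "\<forall>z. g (x + z *s (y - x)) = poly q z"
    using poly_functions_on_line[OF g] by meson
  have "p * q = 0"
  proof (rule ccontr)
    assume nz: "p * q \<noteq> 0"
    have "poly (p * q) z = 0" for z
    proof -
      have "x + z *s (y - x) \<in> V"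
        by (intro vec.subspace_add vec.subspace_scale vec.subspace_diff V x y)
      then have "f (x + z *s (y - x)) * g (x + z *s (y - x)) = 0"
        using fg by blast
      then show ?thesis
        by (simp only: p[rule_format] q[rule_format] poly_mult)
    qed
    then have "{z. poly (p * q) z = 0} = UNIV" by blast
    then show False
      using poly_roots_finite[OF nz] infinite_UNIV_char_0 by (metis (full_types))
  qed
  moreover have "poly p 0 \<noteq> 0"
    using x(2) p[rule_format, of 0] by simp
  moreover have "poly q 1 \<noteq> 0"
    using y(2) q[rule_format, of 1] by simp
  ultimately show False by auto
qed

lemma directional_deriv_zero: "f \<in> poly_functions \<Longrightarrow> directional_deriv f x 0 = 0"
  using directional_deriv_linear[of f x] by auto

lemma directional_deriv_vec_add:
  assumes "f \<in> poly_functions"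
  shows "directional_deriv f x (v + w) = directional_deriv f x v + directional_deriv f x w"
proof -
  obtain a where "\<forall>v. directional_deriv f x v = (\<Sum>i\<in>UNIV. a i * v $ i)"
    using directional_deriv_linear[OF assms, of x] by blast
  then show ?thesis by (simp add: distrib_left sum.distrib)
qed

lemma directional_deriv_vec_scale:
  assumes "f \<in> poly_functions"
  shows "directional_deriv f x (c *s v) = c * directional_deriv f x v"
proof -
  obtain a where "\<forall>v. directional_deriv f x v = (\<Sum>i\<in>UNIV. a i * v $ i)"
    using directional_deriv_linear[OF assms, of x] by blast
  then show ?thesis by (simp add: sum_distrib_left mult.left_commute)
qed

lemma subspace_tangent_space: "vec.subspace (tangent_space X p)"
  unfolding vec.subspace_def tangent_space_def
  by (auto simp: directional_deriv_zero directional_deriv_vec_add directional_deriv_vec_scale)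

lemma algebraic_set_tangent_space: "algebraic_set (tangent_space X p)"
proof -
  let ?S = "(\<lambda>f v. directional_deriv f p v) ` {f \<in> poly_functions. \<forall>y\<in>X. f y = 0}"
  have "?S \<subseteq> poly_functions"
    by (auto intro: poly_functions_directional_deriv)
  moreover have "tangent_space X p = {v. \<forall>f\<in>?S. f v = 0}"
    by (auto simp: tangent_space_def)
  ultimately show ?thesis
    unfolding algebraic_set_def by (intro exI[of _ ?S]) simp
qed

lemma tangent_spaceD:
  "v \<in> tangent_space X p \<Longrightarrow> f \<in> poly_functions \<Longrightarrow> (\<And>y. y \<in> X \<Longrightarrow> f y = 0) \<Longrightarrow> directional_deriv f p v = 0"
  by (simp add: tangent_space_def)

text \<open>
  Two polynomials representing the same component of \<open>F\<close> differ by one that vanishes on \<open>X\<close>, whose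
  derivative in a tangent direction is zero.
\<close>

lemma differential_component:
  assumes v: "v \<in> tangent_space X p" and f: "f \<in> poly_functions" "\<And>y. y \<in> X \<Longrightarrow> f y = F y $ i"
  shows "differential X F p v $ i = directional_deriv f p v"
proof -
  define h where "h = (SOME f. f \<in> poly_functions \<and> (\<forall>y\<in>X. f y = F y $ i))"
  have "h \<in> poly_functions \<and> (\<forall>y\<in>X. h y = F y $ i)"
    unfolding h_def by (rule someI[of _ f]) (use f in simp)
  then have "directional_deriv (\<lambda>x. h x - f x) p v = 0"
    using f by (intro tangent_spaceD[OF v] poly_functions_diff) auto
  then show ?thesis
    using \<open>h \<in> _ \<and> _\<close> f(1) by (simp add: differential_def h_def[symmetric] directional_deriv_diff)
qed

lemma directional_deriv_comp_differential:
  assumes v: "v \<in> tangent_space X p" and p: "p \<in> X"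
    and H: "\<And>i. (\<lambda>x. H x $ i) \<in> poly_functions" "\<And>y. y \<in> X \<Longrightarrow> H y = F y"
    and f: "f \<in> poly_functions"
  shows "directional_deriv (\<lambda>x. f (H x)) p v = directional_deriv f (F p) (differential X F p v)"
proof -
  have "differential X F p v $ i = directional_deriv (\<lambda>x. H x $ i) p v" for i
    by (rule differential_component[OF v H(1)]) (simp add: H(2))
  then have "(\<chi> i. directional_deriv (\<lambda>x. H x $ i) p v) = differential X F p v"
    by (simp add: vec_eq_iff)
  then show ?thesis
    using directional_deriv_comp[OF f H(1)] H(2)[OF p] by simp
qed

lemma action_polynomial_extension:
  assumes act: "algebraic_Gm_action X \<sigma>" and t: "t \<noteq> 0"
  shows "\<exists>H. (\<forall>i. (\<lambda>x. H x $ i) \<in> poly_functions) \<and> (\<forall>x\<in>X. H x = \<sigma> t x)"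
proof -
  have "\<forall>i. \<exists>h. h \<in> poly_functions \<and> (\<forall>x\<in>X. h x = \<sigma> t x $ i)"
  proof
    fix i
    obtain K c where K: "\<And>n. n \<in> K \<Longrightarrow> c n \<in> semi_invariants X \<sigma> n"
      and eq: "\<And>t x. t \<noteq> 0 \<Longrightarrow> x \<in> X \<Longrightarrow> \<sigma> t x $ i = (\<Sum>n\<in>K. t powi n * c n x)"
      using action_coordinate_decomposition[OF act, of i] by meson
    have "(\<lambda>x. \<Sum>n\<in>K. t powi n * c n x) \<in> poly_functions"
      by (intro poly_functions_sum poly_functions_mult poly_functions_const semi_invariants_poly[OF K])
    then show "\<exists>h. h \<in> poly_functions \<and> (\<forall>x\<in>X. h x = \<sigma> t x $ i)"
      using eq[OF t] by (intro exI[of _ "\<lambda>x. \<Sum>n\<in>K. t powi n * c n x"]) simp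
  qed
  from choice[OF this] obtain h where h: "\<forall>i. h i \<in> poly_functions \<and> (\<forall>x\<in>X. h i x = \<sigma> t x $ i)" ..
  show ?thesis
    by (rule exI[of _ "\<lambda>x. \<chi> i. h i x"]) (simp add: h vec_eq_iff)
qed

text \<open>
  The action laws are the chain rule at the fixed point. Differentiating the weight decomposition of
  the coordinates of \<open>\<sigma> t\<close> term by term shows that the linearised action depends algebraically on \<open>t\<close>.
\<close>

lemma algebraic_Gm_action_tangent_space:
  assumes act: "algebraic_Gm_action X \<sigma>" and p: "p \<in> fixed_points X \<sigma>"
  shows "algebraic_Gm_action (tangent_space X p) (tangent_action X \<sigma> p)"
  unfolding algebraic_Gm_action_def
proof (intro conjI allI impI ballI)
  let ?V = "tangent_space X p" and ?\<rho> = "tangent_action X \<sigma> p"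
  have fixed: "\<sigma> t p = p" if "t \<noteq> 0" for t
    using p that by (simp add: fixed_points_def)
  have pX: "p \<in> X" using p by (simp add: fixed_points_def)
  have into: "\<sigma> t x \<in> X" if "t \<noteq> 0" "x \<in> X" for t x
    using act that by (simp add: algebraic_Gm_action_def)
  have comp: "\<sigma> (s * t) x = \<sigma> s (\<sigma> t x)" if "s \<noteq> 0" "t \<noteq> 0" "x \<in> X" for s t x
    using act that by (simp add: algebraic_Gm_action_def)
  show V: "?\<rho> t v \<in> ?V" if t: "t \<noteq> 0" and v: "v \<in> ?V" for t v
    unfolding tangent_space_def
  proof (intro CollectI ballI impI)
    fix f :: "complex ^ 'a \<Rightarrow> complex"
    assume f: "f \<in> poly_functions" "\<forall>y\<in>X. f y = 0"
    obtain H where H: "\<And>i. (\<lambda>x. H x $ i) \<in> poly_functions" "\<And>x. x \<in> X \<Longrightarrow> H x = \<sigma> t x"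
      using action_polynomial_extension[OF act t] by meson
    have "directional_deriv (\<lambda>x. f (H x)) p v = 0"
      by (rule tangent_spaceD[OF v poly_functions_comp[OF f(1) H(1)]]) (simp add: f(2) H(2) into t)
    then show "directional_deriv f p (?\<rho> t v) = 0"
      using directional_deriv_comp_differential[OF v pX H f(1)] fixed[OF t]
      by (simp add: tangent_action_def)
  qed
  show "?\<rho> 1 v = v" if v: "v \<in> ?V" for v
  proof -
    have "differential X (\<sigma> 1) p v $ i = v $ i" for i
      using differential_component[OF v poly_functions_coord, of i "\<sigma> 1" i] act
      by (simp add: algebraic_Gm_action_def directional_deriv_coord)
    then show ?thesis by (simp add: tangent_action_def vec_eq_iff)
  qed
  show "?\<rho> (s * t) v = ?\<rho> s (?\<rho> t v)" if s: "s \<noteq> 0" and t: "t \<noteq> 0" and v: "v \<in> ?V" for s t v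
  proof -
    obtain H where H: "\<And>i. (\<lambda>x. H x $ i) \<in> poly_functions" "\<And>x. x \<in> X \<Longrightarrow> H x = \<sigma> t x"
      using action_polynomial_extension[OF act t] by meson
    obtain G where G: "\<And>i. (\<lambda>x. G x $ i) \<in> poly_functions" "\<And>x. x \<in> X \<Longrightarrow> G x = \<sigma> s x"
      using action_polynomial_extension[OF act s] by meson
    have "differential X (\<sigma> (s * t)) p v $ i = differential X (\<sigma> s) p (differential X (\<sigma> t) p v) $ i" for i
    proof -
      have "differential X (\<sigma> (s * t)) p v $ i = directional_deriv (\<lambda>x. G (H x) $ i) p v"
        by (rule differential_component[OF v poly_functions_comp[OF G(1) H(1)]])
          (simp add: G(2) H(2) into comp s t)
      also have "\<dots> = directional_deriv (\<lambda>x. G x $ i) p (differential X (\<sigma> t) p v)"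
        using directional_deriv_comp_differential[OF v pX H G(1)] fixed[OF t] by simp
      also have "\<dots> = differential X (\<sigma> s) p (differential X (\<sigma> t) p v) $ i"
        using V[OF t v] G(2) unfolding tangent_action_def
        by (intro differential_component[OF _ G(1), symmetric]) simp_all
      finally show ?thesis .
    qed
    then show ?thesis by (simp add: tangent_action_def vec_eq_iff)
  qed
  fix i
  obtain K c where K: "finite K" "\<And>n. n \<in> K \<Longrightarrow> c n \<in> semi_invariants X \<sigma> n"
    and eq: "\<And>t x. t \<noteq> 0 \<Longrightarrow> x \<in> X \<Longrightarrow> \<sigma> t x $ i = (\<Sum>n\<in>K. t powi n * c n x)"
    using action_coordinate_decomposition[OF act, of i] by meson
  note c = K(2)[THEN semi_invariants_poly]
  show "\<exists>f\<in>laurent_poly_functions. \<forall>t. t \<noteq> 0 \<longrightarrow> (\<forall>v\<in>?V. ?\<rho> t v $ i = f (t, v))"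
  proof (intro bexI allI impI ballI)
    show "(\<lambda>(t, v). \<Sum>n\<in>K. t powi n * directional_deriv (c n) p v) \<in> laurent_poly_functions"
      by (intro laurent_poly_functions_if_decomposed K poly_functions_directional_deriv c)
    fix t :: complex and v assume t: "t \<noteq> 0" and v: "v \<in> ?V"
    have "?\<rho> t v $ i = directional_deriv (\<lambda>x. \<Sum>n\<in>K. t powi n * c n x) p v"
      unfolding tangent_action_def
      by (rule differential_component[OF v], intro poly_functions_sum poly_functions_mult
          poly_functions_const c) (simp_all add: eq t)
    also have "\<dots> = (\<Sum>n\<in>K. t powi n * directional_deriv (c n) p v)"
      by (rule directional_deriv_sum_scaled[OF K(1) c])
    finally show "?\<rho> t v $ i = (case (t, v) of (t, v) \<Rightarrow> \<Sum>n\<in>K. t powi n * directional_deriv (c n) p v)"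
      by simp
  qed
qed

lemma laurent_single_coeff:
  fixes a :: "int \<Rightarrow> complex"
  assumes K: "finite K" and eq: "\<And>t. t \<noteq> 0 \<Longrightarrow> (\<Sum>n\<in>K. t powi n * a n) = t powi k * b" and b: "b \<noteq> 0"
  shows "k \<in> K" "a k = b"
proof -
  have "(if k \<in> K then a k else 0) - (if k = k then b else 0) = 0"
  proof (rule laurent_coeffs_zero[of "insert k K" "\<lambda>n. (if n \<in> K then a n else 0) - (if n = k then b else 0)"])
    fix t :: complex assume "t \<noteq> 0"
    have "(\<Sum>n\<in>insert k K. t powi n * (if n \<in> K then a n else 0)) = (\<Sum>n\<in>K. t powi n * a n)"
      by (rule sum.mono_neutral_cong_right) (use K in auto)
    moreover have "(\<Sum>n\<in>insert k K. t powi n * (if n = k then b else 0)) = (\<Sum>n\<in>{k}. t powi n * b)"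
      by (rule sum.mono_neutral_cong_right) (use K in auto)
    moreover have "(\<Sum>n\<in>{k}. t powi n * b) = t powi k * b" by simp
    ultimately show "(\<Sum>n\<in>insert k K. t powi n * ((if n \<in> K then a n else 0) - (if n = k then b else 0))) = 0"
      using eq[OF \<open>t \<noteq> 0\<close>] by (simp add: right_diff_distrib sum_subtractf del: sum.insert sum.insert_if)
  qed (use K in simp_all)
  then show "k \<in> K" "a k = b"
    using b by (auto split: if_splits)
qed

text \<open>
  On a weight vector only the part of weight \<open>k\<close> of a coordinate function can be nonzero, and for
  some coordinate it is.
\<close>

lemma semi_invariant_of_weight:
  assumes act: "algebraic_Gm_action V \<rho>" and k: "k \<in> weights V \<rho>"
  shows "\<exists>f\<in>semi_invariants V \<rho> k. \<exists>v\<in>V. f v \<noteq> 0"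
proof -
  obtain v where v: "v \<in> V" "v \<noteq> 0" "\<And>t. t \<noteq> 0 \<Longrightarrow> \<rho> t v = t powi k *s v"
    using k unfolding weights_def by blast
  obtain i where i: "v $ i \<noteq> 0"
    using v(2) by (auto simp: vec_eq_iff)
  obtain K c where K: "finite K" "\<And>n. n \<in> K \<Longrightarrow> c n \<in> semi_invariants V \<rho> n"
    and eq: "\<And>t x. t \<noteq> 0 \<Longrightarrow> x \<in> V \<Longrightarrow> \<rho> t x $ i = (\<Sum>n\<in>K. t powi n * c n x)"
    using action_coordinate_decomposition[OF act, of i] by meson
  have "(\<Sum>n\<in>K. t powi n * c n v) = t powi k * v $ i" if "t \<noteq> 0" for t
    using eq[OF that v(1)] v(3)[OF that] by simp
  from laurent_single_coeff[OF K(1) this i] show ?thesis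
    using i by (intro bexI[OF _ K(2)] bexI[OF _ v(1)]) simp_all
qed

text \<open>
  The weight-\<open>k\<close> part of a coordinate function has the coordinate of the weight vector \<open>v\<close> as its
  derivative in the direction \<open>v\<close>. As \<open>v\<close> is tangent to \<open>X\<close>, a nonzero derivative means that the
  function does not vanish on \<open>X\<close>.
\<close>

lemma semi_invariant_of_tangent_weight:
  assumes act: "algebraic_Gm_action X \<sigma>"
    and k: "k \<in> weights (tangent_space X p) (tangent_action X \<sigma> p)"
  shows "\<exists>f\<in>semi_invariants X \<sigma> k. \<exists>x\<in>X. f x \<noteq> 0"
proof -
  obtain v where v: "v \<in> tangent_space X p" "v \<noteq> 0"
    "\<And>t. t \<noteq> 0 \<Longrightarrow> tangent_action X \<sigma> p t v = t powi k *s v"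
    using k unfolding weights_def by blast
  obtain i where i: "v $ i \<noteq> 0"
    using v(2) by (auto simp: vec_eq_iff)
  obtain K c where K: "finite K" "\<And>n. n \<in> K \<Longrightarrow> c n \<in> semi_invariants X \<sigma> n"
    and eq: "\<And>t x. t \<noteq> 0 \<Longrightarrow> x \<in> X \<Longrightarrow> \<sigma> t x $ i = (\<Sum>n\<in>K. t powi n * c n x)"
    using action_coordinate_decomposition[OF act, of i] by meson
  note c = K(2)[THEN semi_invariants_poly]
  have "(\<Sum>n\<in>K. t powi n * directional_deriv (c n) p v) = t powi k * v $ i" if t: "t \<noteq> 0" for t
  proof -
    have "(\<Sum>n\<in>K. t powi n * directional_deriv (c n) p v) =
        directional_deriv (\<lambda>x. \<Sum>n\<in>K. t powi n * c n x) p v"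
      by (rule directional_deriv_sum_scaled[OF K(1) c, symmetric])
    also have "\<dots> = differential X (\<sigma> t) p v $ i"
      by (rule differential_component[OF v(1), symmetric], intro poly_functions_sum
          poly_functions_mult poly_functions_const c) (simp_all add: eq t)
    finally show ?thesis
      using v(3)[OF t] by (simp add: tangent_action_def)
  qed
  from laurent_single_coeff[OF K(1) this i]
  have k: "k \<in> K" and ck: "directional_deriv (c k) p v = v $ i" by simp_all
  have "\<exists>x\<in>X. c k x \<noteq> 0"
    using tangent_spaceD[OF v(1) c[OF k]] ck i by auto
  then show ?thesis
    using K(2)[OF k] by blast
qed

section \<open>Projective space\<close>

lemma zar_projective_space:
  "zar projective_space =
    topology_generated_by {{L \<in> projective_points. \<exists>v\<in>L. F v \<noteq> 0} |F. \<exists>d. homogeneous d F}"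
  by (simp add: projective_space_def Let_def)

lemma reg_projective_space:
  "f \<in> reg projective_space U \<longleftrightarrow>
    (\<forall>L\<in>U. \<exists>W d G H. openin (zar projective_space) W \<and> L \<in> W \<and> W \<subseteq> U \<and>
       homogeneous d G \<and> homogeneous d H \<and> (\<forall>M\<in>W. \<forall>v\<in>M - {0}. H v \<noteq> 0 \<and> f M = G v / H v))"
  by (simp add: projective_space_def Let_def)

lemma homogeneous_const: "homogeneous 0 (\<lambda>_. c)"
  by (simp add: homogeneous_def poly_functions_const)

lemma homogeneous_coord: "homogeneous 1 (\<lambda>v. v $ i)"
  by (simp add: homogeneous_def poly_functions_coord)

lemma homogeneous_add:
  "homogeneous d F \<Longrightarrow> homogeneous d G \<Longrightarrow> homogeneous d (\<lambda>v. F v + G v)"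
  by (simp add: homogeneous_def poly_functions_add distrib_left)

lemma homogeneous_mult:
  "homogeneous d F \<Longrightarrow> homogeneous e G \<Longrightarrow> homogeneous (d + e) (\<lambda>v. F v * G v)"
  by (simp add: homogeneous_def poly_functions_mult power_add)

lemma openin_projective_space:
  assumes "homogeneous d F"
  shows "openin (zar projective_space) {L \<in> projective_points. \<exists>v\<in>L. F v \<noteq> 0}"
  unfolding zar_projective_space
  by (rule topology_generated_by_Basis, intro CollectI exI[of _ F]) (use assms in auto)

lemma projective_pointE:
  assumes "L \<in> projective_points"
  obtains v where "v \<noteq> 0" "L = vec.span {v}" "v \<in> L"
  using assms vec.span_base[of _ "{_}"] by (auto simp: projective_points_def)

text \<open>
  The lines that form the points of projective space contain the zero vector, at which a homogeneous
  function of degree 0 may well be nonzero; so the comparison is made with a nonzero \<open>v\<close>.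
\<close>

lemma homogeneous_nonzero_on_line:
  fixes v :: "complex ^ 'm"
  assumes F: "homogeneous d F" and v: "v \<in> vec.span {w}" "v \<noteq> 0"
  shows "(\<exists>y\<in>vec.span {w}. F y \<noteq> 0) \<longleftrightarrow> F v \<noteq> 0"
proof
  assume "\<exists>y\<in>vec.span {w}. F y \<noteq> 0"
  then obtain y where y: "y \<in> vec.span {w}" "F y \<noteq> 0" by blast
  obtain a b where a: "v = a *s w" and b: "y = b *s w"
    using v(1) y(1) by (auto simp: vec.span_singleton)
  have "a \<noteq> 0" using a v(2) by auto
  then have "y = (b / a) *s v"
    by (simp add: a b)
  then have "F y = (b / a) ^ d * F v"
    using F by (simp only: homogeneous_def)
  then show "F v \<noteq> 0" using y(2) by auto
qed (use v in blast)

lemma topspace_projective_space [simp]: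
  "topspace (zar (projective_space :: (complex ^ 'm) set space_with_functions)) = projective_points"
proof -
  let ?P = "projective_space :: (complex ^ 'm) set space_with_functions"
  have eq: "{L \<in> projective_points. \<exists>v\<in>L. (1 :: complex) \<noteq> 0} =
      (projective_points :: (complex ^ 'm) set set)"
    by (auto elim: projective_pointE)
  have "openin (zar ?P) {L \<in> projective_points. \<exists>v\<in>L. (1 :: complex) \<noteq> 0}"
    by (rule openin_projective_space[OF homogeneous_const])
  then have "projective_points \<subseteq> topspace (zar ?P)"
    unfolding eq by (rule openin_subset)
  moreover have "topspace (zar ?P) \<subseteq> projective_points"
    unfolding zar_projective_space topology_generated_by_topspace by auto
  ultimately show ?thesis by simp
qed

lemma function_space_projective_space:
  "function_space (projective_space :: (complex ^ 'm) set space_with_functions)"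
proof (rule function_space_if_locally)
  let ?P = "projective_space :: (complex ^ 'm) set space_with_functions"
  define fr where "fr = (\<lambda>W. {f :: (complex ^ 'm) set \<Rightarrow> complex.
    \<exists>d G H. homogeneous d G \<and> homogeneous d H \<and> (\<forall>M\<in>W. \<forall>v\<in>M - {0}. H v \<noteq> 0 \<and> f M = G v / H v)})"
  have fr_iff: "f \<in> fr W \<longleftrightarrow> (\<exists>d G H. homogeneous d G \<and> homogeneous d H \<and>
      (\<forall>M\<in>W. \<forall>v\<in>M - {0}. H v \<noteq> 0 \<and> f M = G v / H v))" for f W
    by (simp add: fr_def)
  have frI: "f \<in> fr W" if "homogeneous d G" "homogeneous d H"
      "\<And>M v. M \<in> W \<Longrightarrow> v \<in> M \<Longrightarrow> v \<noteq> 0 \<Longrightarrow> H v \<noteq> 0 \<and> f M = G v / H v" for f W d G H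
    unfolding fr_iff by (intro exI[of _ d] exI[of _ G] exI[of _ H]) (use that in simp)
  have sub: "W \<subseteq> projective_points" if "openin (zar ?P) W" for W
    using openin_subset[OF that] by simp
  show "f \<in> reg ?P U \<longleftrightarrow> (\<forall>x\<in>U. \<exists>W. openin (zar ?P) W \<and> x \<in> W \<and> W \<subseteq> U \<and> f \<in> fr W)" for U f
    by (simp add: reg_projective_space fr_iff)
  show "f \<in> fr W'" if "f \<in> fr W" "W' \<subseteq> W" for W W' f
    using that unfolding fr_iff by (meson subsetD)
  show "f' \<in> fr W" if "f \<in> fr W" "\<And>x. x \<in> W \<Longrightarrow> f' x = f x" for W f f'
    using that by (simp add: fr_iff)
  show "(\<lambda>_. c) \<in> fr W" for W c
    by (rule frI[OF homogeneous_const[of c] homogeneous_const[of 1]]) simp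
  fix W assume opW: "openin (zar ?P) W"
  fix f assume "f \<in> fr W"
  then obtain d G H where G: "homogeneous d G" and H: "homogeneous d H"
    and f: "\<And>M v. M \<in> W \<Longrightarrow> v \<in> M - {0} \<Longrightarrow> H v \<noteq> 0 \<and> f M = G v / H v"
    unfolding fr_iff by meson
  {
    fix f' assume "f' \<in> fr W"
    then obtain d' G' H' where G': "homogeneous d' G'" and H': "homogeneous d' H'"
      and f': "\<And>M v. M \<in> W \<Longrightarrow> v \<in> M - {0} \<Longrightarrow> H' v \<noteq> 0 \<and> f' M = G' v / H' v"
      unfolding fr_iff by meson
    show "(\<lambda>x. f x * f' x) \<in> fr W"
      by (rule frI[OF homogeneous_mult[OF G G'] homogeneous_mult[OF H H']]) (use f f' in auto)
    have "homogeneous (d + d') (\<lambda>v. G v * H' v + H v * G' v)"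
      by (intro homogeneous_add homogeneous_mult G G' H H')
    then show "(\<lambda>x. f x + f' x) \<in> fr W"
      by (rule frI[OF _ homogeneous_mult[OF H H']]) (use f f' in \<open>auto simp: field_simps\<close>)
  }
  show "(\<lambda>x. inverse (f x)) \<in> fr W" if nz: "\<And>x. x \<in> W \<Longrightarrow> f x \<noteq> 0"
  proof (rule frI[OF H G])
    fix M v assume M: "M \<in> W" and v: "v \<in> M" "v \<noteq> 0"
    have "H v \<noteq> 0 \<and> f M = G v / H v" using f[OF M] v by simp
    with nz[OF M] show "G v \<noteq> 0 \<and> inverse (f M) = H v / G v" by auto
  qed
  have "f M \<noteq> 0 \<longleftrightarrow> (\<exists>v\<in>M. G v \<noteq> 0)" if M: "M \<in> W" for M
  proof -
    obtain v where v: "v \<noteq> 0" "M = vec.span {v}" "v \<in> M"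
      using sub[OF opW] M projective_pointE by blast
    then have "(\<exists>v\<in>M. G v \<noteq> 0) \<longleftrightarrow> G v \<noteq> 0"
      using homogeneous_nonzero_on_line[OF G, of v v] by simp
    then show ?thesis using f[OF M, of v] v by auto
  qed
  then have "{x \<in> W. f x \<noteq> 0} = W \<inter> {L \<in> projective_points. \<exists>v\<in>L. G v \<noteq> 0}"
    using sub[OF opW] by auto
  then show "openin (zar ?P) {x \<in> W. f x \<noteq> 0}"
    using opW openin_projective_space[OF G] by auto
qed

lemma linear_coordinate_poly:
  fixes f :: "complex ^ 'n \<Rightarrow> complex ^ 'm"
  assumes "Vector_Spaces.linear (*s) (*s) f"
  shows "(\<lambda>x. f x $ i) \<in> poly_functions"
proof -
  have "f x $ i = (\<Sum>j\<in>UNIV. matrix f $ i $ j * x $ j)" for x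
  proof -
    have "f x $ i = (matrix f *v x) $ i"
      by (simp only: matrix_works[OF assms])
    then show ?thesis
      by (simp add: matrix_vector_mult_def)
  qed
  moreover have "(\<lambda>x. \<Sum>j\<in>UNIV. matrix f $ i $ j * x $ j) \<in> poly_functions"
    by (intro poly_functions_sum poly_functions_mult poly_functions_const poly_functions_coord)
  ultimately show ?thesis by simp
qed

text \<open>
  An affine embedding \<open>e\<close> of \<open>V\<close> whose image is the hyperplane on which the coordinate \<open>i0\<close> is 1,
  and a linear map \<open>r\<close> that inverts it there.
\<close>

definition affine_chart ::
  "(complex ^ 'n) set \<Rightarrow> 'm::finite \<Rightarrow> (complex ^ 'n \<Rightarrow> complex ^ 'm) \<Rightarrow> (complex ^ 'm \<Rightarrow> complex ^ 'n) \<Rightarrow> bool"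
  where
  "affine_chart V i0 e r \<longleftrightarrow>
    (\<forall>i. (\<lambda>v. e v $ i) \<in> poly_functions) \<and> (\<forall>i. homogeneous 1 (\<lambda>y. r y $ i)) \<and>
    (\<forall>v\<in>V. r (e v) = v) \<and> (\<forall>v. e v $ i0 = 1) \<and>
    (\<forall>y. r y \<in> V) \<and> (\<forall>y. y $ i0 = 1 \<longrightarrow> e (r y) = y)"

lemma subspace_affine_chart:
  fixes V :: "(complex ^ 'n) set" and i0 :: "'m::finite"
  assumes V: "vec.subspace V" and dim: "CARD('m) = vec.dim V + 1"
  shows "\<exists>e r. affine_chart V i0 e r"
proof -
  obtain B where B: "B \<subseteq> V" "vec.independent B" "V \<subseteq> vec.span B" "card B = vec.dim V"
    by (rule vec.basis_exists)
  have spanB: "vec.span B = V"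
    using B V by (simp add: vec.span_minimal subset_antisym)
  have finB: "finite B"
    using B(2) by (rule vec.finiteI_independent)
  let ?I = "UNIV - {i0}"
  have "card ?I = card B"
    using B(4) dim by simp
  then obtain \<beta> where \<beta>: "bij_betw \<beta> ?I B"
    using finB finite_same_card_bij[of ?I B] by auto
  define \<gamma> where "\<gamma> = inv_into ?I \<beta>"
  have \<gamma>\<beta>: "\<gamma> (\<beta> i) = i" if "i \<noteq> i0" for i
    using bij_betw_inv_into_left[OF \<beta>, of i] that by (simp add: \<gamma>_def)
  have \<beta>B: "\<beta> i \<in> B" if "i \<noteq> i0" for i
    using bij_betwE[OF \<beta>] that by auto
  obtain l :: "complex ^ 'n \<Rightarrow> complex ^ 'm" where l: "Vector_Spaces.linear (*s) (*s) l"
    and lB: "\<And>b. b \<in> B \<Longrightarrow> l b = axis (\<gamma> b) 1"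
    using vec.linear_independent_extend[OF B(2), of "\<lambda>b. axis (\<gamma> b) 1"] by blast
  interpret l: Vector_Spaces.linear "(*s)" "(*s)" l by (rule l)
  define r where "r y = (\<Sum>i\<in>?I. y $ i *s \<beta> i)" for y :: "complex ^ 'm"
  define e where "e v = (\<chi> i. if i = i0 then 1 else l v $ i)" for v
  have rV: "r y \<in> V" for y
    unfolding r_def by (intro vec.subspace_sum vec.subspace_scale V) (use \<beta>B B(1) in auto)
  have lr: "l (r y) $ i = y $ i" if i: "i \<noteq> i0" for y i
  proof -
    have "l (r y) $ i = (\<Sum>j\<in>?I. y $ j * axis j 1 $ i)"
      unfolding r_def l.sum l.scale using lB \<beta>B \<gamma>\<beta> by (simp add: sum_component)
    also have "\<dots> = (\<Sum>j\<in>?I. if j = i then y $ i else 0)"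
      by (intro sum.cong) (auto simp: axis_def)
    also have "\<dots> = y $ i" using i by simp
    finally show ?thesis .
  qed
  have rl: "r (l v) = v" if "v \<in> V" for v
  proof -
    have "v \<in> vec.span B" using that spanB by simp
    then obtain u where u: "v = (\<Sum>b\<in>B. u b *s b)"
      unfolding vec.span_finite[OF finB] by auto
    then have v: "v = r (\<chi> i. u (\<beta> i))"
      unfolding r_def using sum.reindex_bij_betw[OF \<beta>, of "\<lambda>b. u b *s b"] by simp
    have "r (l v) = (\<Sum>i\<in>?I. l (r (\<chi> i. u (\<beta> i))) $ i *s \<beta> i)"
      by (subst v) (simp only: r_def)
    also have "\<dots> = (\<Sum>i\<in>?I. (\<chi> i. u (\<beta> i)) $ i *s \<beta> i)"
      by (intro sum.cong) (simp_all add: lr)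
    also have "\<dots> = v"
      by (subst v) (simp only: r_def)
    finally show ?thesis .
  qed
  have "r (e v) = r (l v)" for v
    unfolding r_def by (intro sum.cong) (simp_all add: e_def)
  then have re: "r (e v) = v" if "v \<in> V" for v
    using rl[OF that] by simp
  have er: "e (r y) = y" if "y $ i0 = 1" for y
    using lr that by (simp add: e_def vec_eq_iff)
  have e_poly: "(\<lambda>v. e v $ i) \<in> poly_functions" for i
    using linear_coordinate_poly[OF l] poly_functions_const[of 1] by (cases "i = i0") (simp_all add: e_def)
  have r_hom: "homogeneous 1 (\<lambda>y. r y $ i)" for i
    unfolding homogeneous_def
  proof (intro conjI allI)
    have "(\<lambda>y. \<Sum>j\<in>?I. y $ j * \<beta> j $ i) \<in> poly_functions"
      by (intro poly_functions_sum poly_functions_mult poly_functions_const poly_functions_coord)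
    then show "(\<lambda>y. r y $ i) \<in> poly_functions"
      by (simp add: r_def sum_component)
    show "r (c *s v) $ i = c ^ 1 * r v $ i" for c v
      by (simp add: r_def sum_component sum_distrib_left mult.assoc)
  qed
  have "affine_chart V i0 e r"
    unfolding affine_chart_def using e_poly r_hom re rV er by (simp add: e_def)
  then show ?thesis by blast
qed

text \<open>
  In the chart, \<open>V\<close> corresponds to the lines on which the coordinate \<open>i0\<close> is not zero: \<open>j v\<close> is the
  line through \<open>e v\<close>, and \<open>k L\<close> is obtained from the point of \<open>L\<close> whose coordinate \<open>i0\<close> is 1. In
  homogeneous coordinates \<open>y\<close>, the components of \<open>k\<close> are the fractions \<open>r y $ i / y $ i0\<close>.
\<close>

lemma subspace_isomorphic_projective_chart:
  fixes V :: "(complex ^ 'n) set" and i0 :: "'m::finite"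
  assumes V: "vec.subspace V" and dim: "CARD('m) = vec.dim V + 1"
  shows "\<exists>C j k. openin (zar (projective_space :: (complex ^ 'm) set space_with_functions)) C \<and>
    morphism (affine_space_of V) projective_space j \<and>
    morphism (open_subspace projective_space C) (affine_space_of V) k \<and>
    (\<forall>v\<in>V. j v \<in> C \<and> k (j v) = v) \<and> (\<forall>L\<in>C. j (k L) = L)"
proof -
  let ?P = "projective_space :: (complex ^ 'm) set space_with_functions"
  let ?A = "affine_space_of V"
  obtain e :: "complex ^ 'n \<Rightarrow> complex ^ 'm" and r where "affine_chart V i0 e r"
    using subspace_affine_chart[OF V dim, of i0] by blast
  then have e: "\<And>i. (\<lambda>v. e v $ i) \<in> poly_functions" and r: "\<And>i. homogeneous 1 (\<lambda>y. r y $ i)"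
    and re: "\<And>v. v \<in> V \<Longrightarrow> r (e v) = v" and e0: "\<And>v. e v $ i0 = 1"
    and rV: "\<And>y. r y \<in> V" and er: "\<And>y. y $ i0 = 1 \<Longrightarrow> e (r y) = y"
    unfolding affine_chart_def by simp_all
  have e_nz: "e v \<noteq> 0" for v
    using e0[of v] by auto
  define C where "C = {L \<in> projective_points. \<exists>v\<in>L. (v :: complex ^ 'm) $ i0 \<noteq> 0}"
  have C: "openin (zar ?P) C"
    unfolding C_def by (rule openin_projective_space[OF homogeneous_coord])
  define j where "j v = vec.span {e v}" for v
  define k where "k L = r (SOME y. y \<in> L \<and> y $ i0 = 1)" for L
  have jP: "j v \<in> projective_points" for v
    using e_nz unfolding j_def projective_points_def by blast
  have e_j: "e v \<in> j v" for v
    unfolding j_def by (rule vec.span_base) simp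
  have jC: "j v \<in> C" for v
    unfolding C_def using jP e_j e0 by (intro CollectI conjI bexI[of _ "e v"]) simp_all
  have k_eq: "\<exists>y. y \<in> L \<and> y $ i0 = 1 \<and> L = vec.span {y} \<and> k L = r y" if L: "L \<in> C" for L
  proof -
    obtain w where w: "w \<noteq> 0" "L = vec.span {w}" "w \<in> L"
      using L unfolding C_def by (auto elim: projective_pointE)
    have "w $ i0 \<noteq> 0"
      using L homogeneous_nonzero_on_line[OF homogeneous_coord, of w w i0] w by (simp add: C_def)
    then have ex: "inverse (w $ i0) *s w \<in> L \<and> (inverse (w $ i0) *s w) $ i0 = 1"
      using w vec.span_scale[of w "{w}"] by simp
    define y where "y = (SOME y. y \<in> L \<and> y $ i0 = 1)"
    have y: "y \<in> L \<and> y $ i0 = 1"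
      unfolding y_def by (rule someI[of _ "inverse (w $ i0) *s w"]) (rule ex)
    then obtain a where a: "y = a *s w"
      unfolding w(2) vec.span_singleton by auto
    have "a \<noteq> 0" using a y by auto
    then have "vec.span {y} = vec.span {w}"
    proof -
      have "w = inverse a *s y" using a \<open>a \<noteq> 0\<close> by simp
      then have "w \<in> vec.span {y}" "y \<in> vec.span {w}"
        using a by (auto simp: vec.span_singleton)
      then show ?thesis
        by (intro subset_antisym vec.span_minimal vec.subspace_span) simp_all
    qed
    then show ?thesis
      using y w(2) by (intro exI[of _ y]) (simp add: k_def y_def)
  qed
  have kj: "k (j v) = v" if v: "v \<in> V" for v
  proof -
    obtain y where y: "y \<in> j v" "y $ i0 = 1" "k (j v) = r y"
      using k_eq[OF jC] by blast
    then obtain a where "y = a *s e v"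
      unfolding j_def vec.span_singleton by auto
    then have "y = e v" using y(2) e0[of v] by simp
    then show ?thesis using y(3) re[OF v] by simp
  qed
  have jk: "j (k L) = L" if L: "L \<in> C" for L
  proof -
    obtain y where y: "y $ i0 = 1" "L = vec.span {y}" "k L = r y"
      using k_eq[OF L] by auto
    then show ?thesis using er by (simp add: j_def)
  qed

  have "morphism ?A ?P j"
  proof -
    interpret function_space ?A by (rule function_space_affine_space_of)
    have pull: "(\<lambda>v. F (e v)) \<in> reg ?A V" if F: "homogeneous d F" for d F
    proof (rule poly_functions_regular[OF poly_functions_comp[OF _ e]])
      show "F \<in> poly_functions" using F by (simp add: homogeneous_def)
    qed
    have opV: "openin (zar ?A) V"
      using openin_topspace[of "zar ?A"] by simp
    have "openin (zar ?A) (j -` U \<inter> topspace (zar ?A))"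
      if U: "U \<in> {{L \<in> projective_points. \<exists>v\<in>L. F v \<noteq> 0} |F. \<exists>d. homogeneous d F}" for U
    proof -
      obtain F d where F: "homogeneous d F" "U = {L \<in> projective_points. \<exists>v\<in>L. F v \<noteq> 0}"
        using U by blast
      have "j -` U \<inter> topspace (zar ?A) = {v \<in> V. F (e v) \<noteq> 0}"
        using homogeneous_nonzero_on_line[OF F(1) e_j[unfolded j_def] e_nz] jP
        by (auto simp: F(2) j_def)
      then show ?thesis
        using openin_nonzero[OF opV pull[OF F(1)]] by simp
    qed
    moreover have "j ` topspace (zar ?A) \<subseteq> topspace (zar ?P)"
      using jP by auto
    ultimately have cont: "continuous_map (zar ?A) (zar ?P) j"
      unfolding zar_projective_space continuous_on_generated_topo_iff by simp
    moreover have "h \<circ> j \<in> reg ?A {x \<in> topspace (zar ?A). j x \<in> U}"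
      if U: "openin (zar ?P) U" and h: "h \<in> reg ?P U" for U h
    proof (rule reg_local)
      show "openin (zar ?A) {x \<in> topspace (zar ?A). j x \<in> U}"
        using cont U by (rule openin_continuous_map_preimage)
      fix x assume x: "x \<in> {x \<in> topspace (zar ?A). j x \<in> U}"
      then obtain W d G H where W: "openin (zar ?P) W" "j x \<in> W" "W \<subseteq> U"
        and G: "homogeneous d G" and H: "homogeneous d H"
        and h_eq: "\<And>M v. M \<in> W \<Longrightarrow> v \<in> M - {0} \<Longrightarrow> H v \<noteq> 0 \<and> h M = G v / H v"
        using h unfolding reg_projective_space mem_Collect_eq by meson
      let ?W = "{x \<in> topspace (zar ?A). j x \<in> W}"
      have op: "openin (zar ?A) ?W"
        using cont W(1) by (rule openin_continuous_map_preimage)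
      have eq: "H (e y) \<noteq> 0 \<and> h (j y) = G (e y) / H (e y)" if "y \<in> ?W" for y
        using h_eq[of "j y" "e y"] that e_j e_nz by simp
      have WV: "?W \<subseteq> V" by auto
      have "(\<lambda>y. G (e y) / H (e y)) \<in> reg ?A ?W"
        using eq by (intro reg_divide op reg_subset[OF opV op WV] pull[OF G] pull[OF H]) blast
      then have "h \<circ> j \<in> reg ?A ?W"
        by (rule reg_cong[OF op]) (use eq in simp)
      then show "\<exists>W. openin (zar ?A) W \<and> x \<in> W \<and> W \<subseteq> {x \<in> topspace (zar ?A). j x \<in> U} \<and> h \<circ> j \<in> reg ?A W"
        using op W x by (intro exI[of _ ?W]) auto
    qed
    ultimately show ?thesis
      unfolding morphism_def by blast
  qed
  moreover have "morphism (open_subspace ?P C) ?A k"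
  proof -
    interpret P: function_space ?P by (rule function_space_projective_space)
    interpret function_space "open_subspace ?P C"
      using C by (rule P.function_space_open_subspace)
    have top: "topspace (zar (open_subspace ?P C)) = C"
      using openin_subset[OF C] by auto
    show ?thesis
    proof (rule morphism_into_affine_space)
      show "k L \<in> V" for L
        unfolding k_def by (rule rV)
      fix i
      have "k M $ i = r v $ i / v $ i0 \<and> v $ i0 \<noteq> 0" if M: "M \<in> C" and v: "v \<in> M - {0}" for M v
      proof -
        obtain y where y: "y $ i0 = 1" "M = vec.span {y}" "k M = r y"
          using k_eq[OF M] by auto
        then obtain a where a: "v = a *s y"
          using v by (auto simp: vec.span_singleton)
        have "a \<noteq> 0" using v a by auto
        moreover have "r v $ i = a * r y $ i"
          using r[of i] unfolding homogeneous_def a by simp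
        ultimately show ?thesis
          using y a by simp
      qed
      then have eq: "\<forall>M\<in>C. \<forall>v\<in>M - {0}. v $ i0 \<noteq> 0 \<and> k M $ i = r v $ i / v $ i0"
        by blast
      have "(\<lambda>L. k L $ i) \<in> reg ?P C"
        unfolding reg_projective_space
        by (rule ballI, rule exI[of _ C], rule exI[of _ 1], rule exI[of _ "\<lambda>y. r y $ i"],
            rule exI[of _ "\<lambda>y. y $ i0"], intro conjI C r homogeneous_coord eq) simp_all
      then show "(\<lambda>L. k L $ i) \<in> reg (open_subspace ?P C) (topspace (zar (open_subspace ?P C)))"
        unfolding top by simp
    qed
  qed
  ultimately show ?thesis
    using C jC kj jk by (intro exI[of _ C] exI[of _ j] exI[of _ k]) simp
qed

lemma birational_if_target_isomorphic_open:
  assumes XV: "birational X V" and V: "function_space V" and P: "function_space P"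
    and C: "openin (zar P) C" and j: "morphism V P j" and k: "morphism (open_subspace P C) V k"
    and jC: "\<And>v. v \<in> topspace (zar V) \<Longrightarrow> j v \<in> C" and kj: "\<And>v. v \<in> topspace (zar V) \<Longrightarrow> k (j v) = v"
    and jk: "\<And>L. L \<in> C \<Longrightarrow> j (k L) = L"
  shows "birational X P"
proof -
  obtain A B where A: "openin (zar X) A" "A \<noteq> {}" and B: "openin (zar V) B" "B \<noteq> {}"
    and iso: "isomorphic (open_subspace X A) (open_subspace V B)"
    using XV unfolding birational_def by meson
  have BV: "B \<subseteq> topspace (zar V)" and AX: "A \<subseteq> topspace (zar X)" and CP: "C \<subseteq> topspace (zar P)"
    using A B C by (auto dest: openin_subset)
  have topA: "topspace (zar (open_subspace X A)) = A" and topB: "topspace (zar (open_subspace V B)) = B"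
    using AX BV by auto
  obtain f h where f: "morphism (open_subspace X A) (open_subspace V B) f"
    and h: "morphism (open_subspace V B) (open_subspace X A) h"
    and hf: "\<And>x. x \<in> A \<Longrightarrow> h (f x) = x" and fh: "\<And>y. y \<in> B \<Longrightarrow> f (h y) = y"
    using iso unfolding isomorphic_def topA topB by meson
  let ?PC = "open_subspace P C"
  have top: "topspace (zar ?PC) = C" using CP by auto
  define D where "D = {L \<in> C. k L \<in> B}"
  have "openin (zar ?PC) {L \<in> topspace (zar ?PC). k L \<in> B}"
    by (rule openin_continuous_map_preimage[OF _ B(1)]) (use k in \<open>simp add: morphism_def\<close>)
  then have DC: "openin (zar ?PC) D"
    unfolding top D_def .
  then have D: "openin (zar P) D"
    using C by (simp add: openin_open_subtopology)
  have fB: "f x \<in> B" if "x \<in> A" for x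
    using f that AX by (auto simp: morphism_def continuous_map_def)
  have jD: "j y \<in> D" if "y \<in> B" for y
    using that BV jC kj by (auto simp: D_def)
  interpret V: function_space V by (rule V)
  interpret P: function_space P by (rule P)
  interpret PC: function_space ?PC using C by (rule P.function_space_open_subspace)
  have "morphism (open_subspace X A) P (j \<circ> f)"
    by (rule morphism_comp[OF f V.morphism_open_subspace[OF B(1) j]])
  then have jf: "morphism (open_subspace X A) (open_subspace P D) (j \<circ> f)"
    by (rule morphism_into_open_subspace[OF _ D]) (use jD fB AX in auto)
  have eq: "open_subspace ?PC D = open_subspace P D"
    by (simp add: open_subspace_def subtopology_subtopology Int_absorb1 D_def)
  have "morphism (open_subspace P D) V k"
    using PC.morphism_open_subspace[OF DC k] unfolding eq .
  then have "morphism (open_subspace P D) (open_subspace V B) k"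
    by (rule morphism_into_open_subspace[OF _ B(1)]) (simp add: D_def)
  from morphism_comp[OF this h]
  have hk: "morphism (open_subspace P D) (open_subspace X A) (h \<circ> k)" .
  have "isomorphic (open_subspace X A) (open_subspace P D)"
    unfolding isomorphic_def
  proof (intro exI conjI ballI)
    show "(h \<circ> k) ((j \<circ> f) x) = x" if "x \<in> topspace (zar (open_subspace X A))" for x
      using that fB[of x] BV kj[of "f x"] hf[of x] by auto
    show "(j \<circ> f) ((h \<circ> k) L) = L" if "L \<in> topspace (zar (open_subspace P D))" for L
      using that fh[of "k L"] jk[of L] by (auto simp: D_def)
  qed (fact jf hk)+
  moreover have "D \<noteq> {}" using B(2) jD by blast
  ultimately show ?thesis
    unfolding birational_def using A D by blast
qed

section \<open>Rationality\<close>

theorem theorem5p0p2: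
  fixes X :: "(complex ^ 'n) set"
    and \<sigma> :: "complex \<Rightarrow> complex ^ 'n \<Rightarrow> complex ^ 'n"
  assumes "Koras_Russell_threefold X \<sigma>"
  shows "birational (affine_space_of X) projective_3_space"
proof -
  obtain p where X: "affine_variety X" and dim: "variety_dim X = 3" and smooth: "smooth_variety X"
    and act: "algebraic_Gm_action X \<sigma>" and p: "fixed_points X \<sigma> = {p}" and hyp: "hyperbolic_at X \<sigma> p"
    and iso: "isomorphic (affine_quotient X \<sigma>)
      (affine_quotient (tangent_space X p) (tangent_action X \<sigma> p))"
    using assms unfolding Koras_Russell_threefold_def by blast
  define V where "V = tangent_space X p"
  define \<rho> where "\<rho> = tangent_action X \<sigma> p"
  have pX: "p \<in> X"
    using p by (auto simp: fixed_points_def)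
  have subV: "vec.subspace V"
    unfolding V_def by (rule subspace_tangent_space)
  have algV: "algebraic_set V"
    unfolding V_def by (rule algebraic_set_tangent_space)
  have actV: "algebraic_Gm_action V \<rho>"
    unfolding V_def \<rho>_def by (rule algebraic_Gm_action_tangent_space[OF act]) (simp add: p)
  have algX: "algebraic_set X"
    using X by (simp add: affine_variety_def)
  have intX: "integral_on X"
    using X by (rule integral_on_if_affine_variety)
  have intV: "integral_on V"
    using subV by (rule integral_on_subspace)
  obtain m n where m: "m \<in> weights V \<rho>" "m > 0" and n: "n \<in> weights V \<rho>" "n < 0"
    using hyp unfolding hyperbolic_at_def Let_def V_def \<rho>_def by blast
  note weightX = semi_invariant_of_tangent_weight[OF act, of _ p, folded V_def \<rho>_def]
  note weightV = semi_invariant_of_weight[OF actV]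
  obtain g u S where splitX: "quotient_splitting X \<sigma> g u S"
    using weightX[OF m(1)] weightX[OF n(1)] quotient_splitting_exists[OF algX intX act _ m(2) _ _ _ n(2)]
    by meson
  obtain g' u' S' where splitV: "quotient_splitting V \<rho> g' u' S'"
    using weightV[OF m(1)] weightV[OF n(1)] quotient_splitting_exists[OF algV intV actV _ m(2) _ _ _ n(2)]
    by meson
  have BX: "restricted_algebra X (invariant_ring X \<sigma>)"
    by (rule restricted_algebra_invariant_ring) (use act in \<open>simp add: algebraic_Gm_action_def\<close>)
  have BV: "restricted_algebra V (invariant_ring V \<rho>)"
    by (rule restricted_algebra_invariant_ring) (use actV in \<open>simp add: algebraic_Gm_action_def\<close>)
  have XV: "birational (affine_space_of X) (affine_space_of V)"
    using birational_if_quotients_isomorphic[OF splitX splitV BX BV intX] iso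
    by (simp add: V_def \<rho>_def)
  have "enat (vec.dim V) = 3"
    using smooth dim pX by (simp add: smooth_variety_def V_def)
  then have "CARD(4) = vec.dim V + 1"
    by (simp add: numeral_eq_enat)
  then obtain C j k where C: "openin (zar projective_3_space) C"
    and j: "morphism (affine_space_of V) projective_3_space j"
    and k: "morphism (open_subspace projective_3_space C) (affine_space_of V) k"
    and jk: "\<forall>v\<in>V. j v \<in> C \<and> k (j v) = v" "\<forall>L\<in>C. j (k L) = L"
    using subspace_isomorphic_projective_chart[OF subV] by blast
  show ?thesis
    by (rule birational_if_target_isomorphic_open[OF XV function_space_affine_space_of
        function_space_projective_space C j k]) (use jk in simp_all)
qed

end
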